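(* For all $\lambda\in\mathcal{F}$ and all $\xi\in X_\lambda$, the Betti coordinates $$b_1=\frac{\overline{\omega_2}z-\omega_2\overline{z}}{A},\qquad b_2=\frac{\omega_1\overline{z}-\overline{\omega_1}z}{A},\qquad A=\omega_1\overline{\omega_2}-\omega_2\overline{\omega_1},$$ where $\omega_1=\omega_1(\lambda)$, $\omega_2=\omega_2(\lambda)$, $z=z(\lambda,\xi)$, satisfy $$\max\{|b_1|,|b_2|\}\le 42.$$
   Context: $\mathcal{F}=\{\lambda\in\mathbb{C}\setminus\{0,1\}: |\lambda|\le1,\ |1-\lambda|\le1,\ \Re(\lambda)\le\frac12\}$. For $\lambda\in\mathcal{F}$, $X_\lambda=\mathbb{C}\setminus((-\infty,0]\cup L_\lambda\cup[1,\infty))$, where $L_\lambda$ is the closed straight line segment joining $0$ and $\lambda$. Periods: $\omega_1=\int_1^\infty\frac{dX}{\sqrt{X(X-1)(X-\lambda)}}$ (integral along the real line, with the square root defined on the plane cut along the negative real axis with $\sqrt1=1$), and $\omega_2=\int_0^{-\infty}\frac{dX}{\sqrt{X(X-1)(X-\lambda)}}$ (integral along the real line, with the square root defined on the plane cut along the positive real axis with $\sqrt{-1}=i$). For $\lambda$ in the interior of $\{|\lambda|\le 1,|1-\lambda|\le1\}$ these equal $\pi F(\lambda)$ and $i\pi F(1-\lambda)$, where $F(\lambda)=\sum_{n\ge0}\frac{(1/2)_n^2}{n!^2}\lambda^n$. Elliptic logarithm: for $\xi\in(-\infty,0)$ put $z(\lambda,\xi)=\int_\xi^{-\infty}\frac{dX}{2\sqrt{X(X-1)(X-\lambda)}}$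 (integral along the real line, same square root as for $\omega_2$). For each fixed $\lambda$, $z(\lambda,\cdot)$ is continued analytically from $(-\infty,0)$ to the simply connected set $X_\lambda$ by continuing north (into the upper half plane) from $(-\infty,0)$; that is, $z(\lambda,\cdot)$ is the analytic function on $X_\lambda$ whose boundary values on $(-\infty,0)$ from above are the given integral. *)

theory Defs
  imports "HOL-Complex_Analysis.Complex_Analysis"
begin

definition legendre_region :: "complex set" where
  "legendre_region = {lam. lam \<noteq> 0 \<and> lam \<noteq> 1 \<and> cmod lam \<le> 1 \<and> cmod (1 - lam) \<le> 1 \<and> Re lam \<le> 1/2}"

definition slit_plane :: "complex \<Rightarrow> complex set" where
  "slit_plane lam = - (complex_of_real ` {..0} \<union> closed_segment 0 lam \<union> complex_of_real ` {1..})"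

definition legendre_cubic :: "complex \<Rightarrow> complex \<Rightarrow> complex" where
  "legendre_cubic lam X = X * (X - 1) * (X - lam)"

text \<open>The square root on the plane cut along the positive real axis whose value at \<open>-1\<close> is \<open>\<i>\<close>.
  The root on the plane cut along the negative real axis with value \<open>1\<close> at \<open>1\<close>
  is the library's \<^const>\<open>csqrt\<close>.\<close>

definition csqrt_pos_cut :: "complex \<Rightarrow> complex" where
  "csqrt_pos_cut w = \<i> * csqrt (- w)"

text \<open>The interval integrals are oriented: a lower limit exceeding the upper one negates the
  integral over the interval.\<close>

definition omega1 :: "complex \<Rightarrow> complex" where
  "omega1 lam = (LBINT X=1..\<infinity>. 1 / csqrt (legendre_cubic lam (complex_of_real X)))"

definition omega2 :: "complex \<Rightarrow> complex" where
  "omega2 lam = (LBINT X=0..-\<infinity>. 1 / csqrt_pos_cut (legendre_cubic lam (complex_of_real X)))"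

definition elliptic_log_real :: "complex \<Rightarrow> real \<Rightarrow> complex" where
  "elliptic_log_real lam x =
     (LBINT X=ereal x..-\<infinity>. 1 / (2 * csqrt_pos_cut (legendre_cubic lam (complex_of_real X))))"

definition is_elliptic_log :: "complex \<Rightarrow> (complex \<Rightarrow> complex) \<Rightarrow> bool" where
  "is_elliptic_log lam z \<longleftrightarrow>
     z holomorphic_on slit_plane lam \<and>
     (\<forall>x<0. (z \<longlongrightarrow> elliptic_log_real lam x) (at (complex_of_real x) within {w. Im w > 0}))"

text \<open>By uniqueness of analytic continuation, any two functions satisfying
  \<^const>\<open>is_elliptic_log\<close> for \<open>lam\<close> in \<^const>\<open>legendre_region\<close> agree on \<^term>\<open>slit_plane lam\<close>;
  the choice operator only leaves the irrelevant values outside that set open.\<close>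

definition elliptic_log :: "complex \<Rightarrow> complex \<Rightarrow> complex" where
  "elliptic_log lam = (SOME z. is_elliptic_log lam z)"

definition betti_denom :: "complex \<Rightarrow> complex" where
  "betti_denom lam = omega1 lam * cnj (omega2 lam) - omega2 lam * cnj (omega1 lam)"

definition betti1 :: "complex \<Rightarrow> complex \<Rightarrow> complex" where
  "betti1 lam xi =
     (cnj (omega2 lam) * elliptic_log lam xi - omega2 lam * cnj (elliptic_log lam xi)) / betti_denom lam"

definition betti2 :: "complex \<Rightarrow> complex \<Rightarrow> complex" where
  "betti2 lam xi =
     (omega1 lam * cnj (elliptic_log lam xi) - cnj (omega1 lam) * elliptic_log lam xi) / betti_denom lam"

end

theory Submission
  imports Defs
begin

text \<open>
  In the coordinate \<open>w = Ln X\<close> the differential of \<open>z\<close> becomes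
  \<open>dw / (2 \<i> sqrt (1 - lam/X) sqrt (1 - X))\<close> with principal square roots, and \<open>w\<close> ranges over a strip with
  two horizontal slits. For \<open>|lam| < |X| < 1\<close> this form is close to \<open>dw / (2 \<i>)\<close>, outside it decays,
  and its singularities on the slits are integrable. Hence \<open>z = \<i> \<sigma> + O(1)\<close> with
  \<open>\<bar>\<sigma>\<bar> \<le> - ln |lam|\<close>, while \<open>\<omega>\<^sub>2 = - \<i> ln |lam| + O(1)\<close>. So \<open>z\<close> is a real multiple \<open>s \<omega>\<^sub>2\<close>,
  \<open>\<bar>s\<bar> \<le> 1\<close>, plus a bounded error, and the Betti coordinates of \<open>s \<omega>\<^sub>2\<close> are \<open>0\<close> and \<open>s\<close>. The error is
  harmless since \<open>A\<close> is bounded below: the integrands of \<open>\<omega>\<^sub>1\<close> and \<open>\<omega>\<^sub>2 / \<i>\<close> enclose an angle of at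
  most \<open>\<pi>/3\<close>, and their absolute values have integrals \<open>\<ge> \<pi>\<close>.
\<close>

section \<open>Elementary estimates\<close>

text \<open>The bound must be uniform although the branch points \<open>lam\<close> and 1 may both
  lie on the unit circle, so that the annulus is empty, and although a path may pass arbitrarily
  close to either of them. Hence every majorant of the form depends on \<open>Re w\<close> alone or
  on \<open>Im w\<close> alone and has only inverse square root singularities; this dictates paths
  made of horizontal segments and one nearly vertical segment. \<open>z\<close> is prescribed by
  boundary values on the upper side of the negative axis, that is, on the line Im w = pi. The strip
  extends beyond this line, so that the boundary condition concerns interior points. Origin of 42: a
  point is reached from the negative axis at a cost of 3 for the value on that axis, 36 for the
  crossing to the right height and 5 + 2 pi for the horizontal move, together at most 52. Replacing
  the logarithmic term by a multiple of \<open>\<omega>\<^sub>2\<close> adds 6. The resulting 58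
  enters a Betti coordinate with factor 2 |\<omega>| / |A| \<le> 2 / pi, which gives less than 41,
  and the multiple of \<open>\<omega>\<^sub>2\<close> adds at most 1.\<close>

lemma norm_diff_le_majorant:
  fixes F F' :: "real \<Rightarrow> complex" and g g' :: "real \<Rightarrow> real"
  assumes "finite S" "a \<le> b" "continuous_on {a..b} F" "continuous_on {a..b} g"
    and F: "\<And>x. x \<in> {a<..<b} - S \<Longrightarrow> (F has_vector_derivative F' x) (at x)"
    and g: "\<And>x. x \<in> {a<..<b} - S \<Longrightarrow> (g has_real_derivative g' x) (at x)"
    and le: "\<And>x. x \<in> {a<..<b} - S \<Longrightarrow> norm (F' x) \<le> g' x"
  shows "norm (F b - F a) \<le> g b - g a"
proof -
  let ?N = "S \<union> {a, b}"
  \<comment> \<open>Nothing is assumed about \<open>F'\<close> and \<open>g'\<close> at the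
    exceptional points and the ends, so both are set to 0 there; the integrals do not see this, and
    the comparison becomes valid on the whole interval.\<close>
  define F1 where "F1 x = (if x \<in> ?N then 0 else F' x)" for x
  define g1 where "g1 x = (if x \<in> ?N then 0 else g' x)" for x
  have fin: "finite ?N" using assms by simp
  have 1: "(F1 has_integral (F b - F a)) {a..b}"
    by (rule fundamental_theorem_of_calculus_interior_strong[OF fin \<open>a \<le> b\<close>])
       (use F assms in \<open>auto simp: F1_def\<close>)
  have 2: "(g1 has_integral (g b - g a)) {a..b}"
    by (rule fundamental_theorem_of_calculus_interior_strong[OF fin \<open>a \<le> b\<close>])
       (use g assms in \<open>auto simp: g1_def has_real_derivative_iff_has_vector_derivative\<close>)
  have "norm (integral {a..b} F1) \<le> integral {a..b} g1"
    using 1 2 le by (intro integral_norm_bound_integral) (auto simp: F1_def g1_def)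
  then show ?thesis using 1 2 by (simp add: integral_unique)
qed

text \<open>For \<open>l \<le> 0\<close> this is the point of \<open>{l..0}\<close> nearest to
  \<open>x\<close>. With \<open>l = Re c\<close>, an increment of \<open>clip\<close> measures the
  part of a horizontal move that runs over the annulus, where the form is nearly constant.\<close>

definition clip :: "real \<Rightarrow> real \<Rightarrow> real" where
  "clip l x = max l (min 0 x)"

text \<open>The interval is cut at \<open>l\<close> and 0, and \<open>k\<close> is subtracted on the
  middle piece only. The derivative bounds are required on open pieces, since the majorants blow up
  at the cut points; only their primitives have to be continuous there, and \<open>Bl\<close>,
  \<open>Bm\<close>, \<open>Br\<close> bound the growth of these primitives regardless of the length
  of the interval.\<close>

lemma norm_diff_clip_le:
  fixes F F' :: "real \<Rightarrow> complex" and gl gm gr :: "real \<Rightarrow> real"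
  assumes "a \<le> b" "l \<le> 0" and cF: "continuous_on {a..b} F"
    and F: "\<And>x. x \<in> {a<..<b} \<Longrightarrow> (F has_vector_derivative F' x) (at x)"
    and c1: "continuous_on UNIV gl" and c2: "continuous_on {l..0} gm" and c3: "continuous_on UNIV gr"
    and d1: "\<And>x. x < l \<Longrightarrow> (gl has_real_derivative gl' x) (at x)"
    and d2: "\<And>x. l < x \<Longrightarrow> x < 0 \<Longrightarrow> (gm has_real_derivative gm' x) (at x)"
    and d3: "\<And>x. 0 < x \<Longrightarrow> (gr has_real_derivative gr' x) (at x)"
    and le1: "\<And>x. x \<in> {a<..<b} \<Longrightarrow> x < l \<Longrightarrow> norm (F' x) \<le> gl' x"
    and le2: "\<And>x. x \<in> {a<..<b} \<Longrightarrow> l < x \<Longrightarrow> x < 0 \<Longrightarrow> norm (F' x - k) \<le> gm' x"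
    and le3: "\<And>x. x \<in> {a<..<b} \<Longrightarrow> 0 < x \<Longrightarrow> norm (F' x) \<le> gr' x"
    and Bl: "\<And>x y. x \<le> l \<Longrightarrow> y \<le> l \<Longrightarrow> gl x - gl y \<le> Bl"
    and Bm: "\<And>x y. x \<in> {l..0} \<Longrightarrow> y \<in> {l..0} \<Longrightarrow> gm x - gm y \<le> Bm"
    and Br: "\<And>x y. 0 \<le> x \<Longrightarrow> 0 \<le> y \<Longrightarrow> gr x - gr y \<le> Br"
  shows "norm (F b - F a - of_real (clip l b - clip l a) * k) \<le> Bl + Bm + Br"
proof -
  have "norm (F (min b l) - F (min a l)) \<le> gl (min b l) - gl (min a l)"
  proof (cases "a < l")
    case True
    show ?thesis
      by (rule norm_diff_le_majorant[where S = "{}" and F' = F' and g' = gl'])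
         (use assms True in \<open>auto intro: continuous_on_subset\<close>)
  next
    case False
    then have "min b l = min a l" using assms by simp
    then show ?thesis by simp
  qed
  then have 1: "norm (F (min b l) - F (min a l)) \<le> Bl"
    using Bl[of "min b l" "min a l"] by simp
  have "norm (F (max b 0) - F (max a 0)) \<le> gr (max b 0) - gr (max a 0)"
  proof (cases "b > 0")
    case True
    show ?thesis
      by (rule norm_diff_le_majorant[where S = "{}" and F' = F' and g' = gr'])
         (use assms True in \<open>auto intro: continuous_on_subset\<close>)
  next
    case False
    then have "max b 0 = max a 0" using assms by simp
    then show ?thesis by simp
  qed
  then have 3: "norm (F (max b 0) - F (max a 0)) \<le> Br"
    using Br[of "max b 0" "max a 0"] by simp
  let ?G = "\<lambda>x. F x - of_real x * k"
  have "norm (?G (clip l b) - ?G (clip l a)) \<le> gm (clip l b) - gm (clip l a)"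
  proof (cases "clip l a < clip l b")
    case True
    then have sub: "{clip l a..clip l b} \<subseteq> {a..b}" "{clip l a..clip l b} \<subseteq> {l..0}"
      using assms by (auto simp: clip_def max_def min_def split: if_splits)
    then have sub': "{clip l a<..<clip l b} \<subseteq> {a<..<b}" "{clip l a<..<clip l b} \<subseteq> {l<..<0}"
      using True assms by (auto simp: clip_def max_def min_def split: if_splits)
    show ?thesis
    proof (rule norm_diff_le_majorant[where S = "{}" and F' = "\<lambda>x. F' x - k" and g' = gm'])
      show "continuous_on {clip l a..clip l b} ?G"
        by (intro continuous_intros continuous_on_subset[OF cF] sub)
      show "continuous_on {clip l a..clip l b} gm"
        by (intro continuous_intros continuous_on_subset[OF c2] sub)
    next
      fix x assume "x \<in> {clip l a<..<clip l b} - {}"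
      then have x: "x \<in> {a<..<b}" "x \<in> {l<..<0}" using sub' by auto
      show "(?G has_vector_derivative F' x - k) (at x)"
        using F[OF x(1)] by (auto intro!: derivative_eq_intros)
      show "(gm has_real_derivative gm' x) (at x)" using d2 x by auto
      show "norm (F' x - k) \<le> gm' x" using le2 x by auto
    qed (use True in auto)
  next
    case False
    then have "clip l a = clip l b" using assms by (auto simp: clip_def)
    then show ?thesis by simp
  qed
  also have "\<dots> \<le> Bm" by (intro Bm) (use assms in \<open>auto simp: clip_def\<close>)
  finally have 2: "norm (?G (clip l b) - ?G (clip l a)) \<le> Bm" .
  \<comment> \<open>For every \<open>x\<close>, the points \<open>min x l\<close>,
    \<open>clip l x\<close> and \<open>max x 0\<close> are \<open>x\<close>, \<open>l\<close> and 0
    in some order, so the values at \<open>l\<close> and 0 cancel in the difference.\<close>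
  have "F b - F a = (F (min b l) - F (min a l)) + (F (clip l b) - F (clip l a))
      + (F (max b 0) - F (max a 0))" if "l < 0"
    using assms(1) that by (cases "a = b") (auto simp: clip_def max_def min_def)
  moreover have "F b - F a = (F (min b l) - F (min a l)) + (F (clip l b) - F (clip l a))
      + (F (max b 0) - F (max a 0))" if "l = 0"
    using assms(1) that by (cases "a = b") (auto simp: clip_def max_def min_def)
  ultimately have eq: "F b - F a - of_real (clip l b - clip l a) * k =
      (F (min b l) - F (min a l)) + (?G (clip l b) - ?G (clip l a)) + (F (max b 0) - F (max a 0))"
    using assms(2) by (force simp: algebra_simps)
  show ?thesis
    unfolding eq using 1 2 3 norm_triangle_ineq norm_triangle_mono by (smt (verit))
qed

section \<open>Bounds for the factors 1 - lam/X and 1 - X\<close>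

lemma legendre_regionD:
  assumes "lam \<in> legendre_region"
  shows "lam \<noteq> 0" "cmod lam \<le> 1" "cmod (1 - lam) \<le> 1" "0 < Re lam" "Re lam \<le> 1/2"
    "(cmod lam)\<^sup>2 \<le> 2 * Re lam" "1/2 \<le> cmod (1 - lam)"
proof -
  show 0: "lam \<noteq> 0" "cmod lam \<le> 1" "cmod (1 - lam) \<le> 1" "Re lam \<le> 1/2"
    using assms by (auto simp: legendre_region_def)
  have "(cmod (1 - lam))\<^sup>2 \<le> 1" using 0 by (simp add: power_le_one)
  then show 1: "(cmod lam)\<^sup>2 \<le> 2 * Re lam"
    unfolding cmod_power2 by (simp add: power2_eq_square algebra_simps)
  have "(cmod lam)\<^sup>2 > 0" using 0 by simp
  then show "Re lam > 0" using 1 by linarith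
  show "1/2 \<le> cmod (1 - lam)" using complex_Re_le_cmod[of "1 - lam"] 0 by simp
qed

text \<open>By the two identities \<open>X P + Q = 1 - lam\<close> and
  \<open>P + (lam/X) Q = 1 - lam\<close> for \<open>P = 1 - lam/X\<close> and \<open>Q = 1 - X\<close>, the two factors
  cannot be small simultaneously.\<close>

lemma factors_sum_ge:
  fixes lam X :: complex
  assumes "lam \<in> legendre_region" "X \<noteq> 0"
  shows "1/2 \<le> cmod (1 - lam / X) + cmod (1 - X)"
proof (cases "cmod X \<le> 1")
  case True
  have "1 - lam = X * (1 - lam / X) + (1 - X)" using assms by (simp add: field_simps)
  then have "cmod (1 - lam) \<le> cmod X * cmod (1 - lam / X) + cmod (1 - X)"
    by (metis norm_mult norm_triangle_ineq)
  also have "\<dots> \<le> 1 * cmod (1 - lam / X) + cmod (1 - X)"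
    using True by (intro add_mono mult_right_mono) auto
  finally show ?thesis using legendre_regionD(7)[OF assms(1)] by simp
next
  case False
  have "1 - lam = (1 - lam / X) + (lam / X) * (1 - X)" using assms by (simp add: field_simps)
  then have "cmod (1 - lam) \<le> cmod (1 - lam / X) + cmod (lam / X) * cmod (1 - X)"
    by (metis norm_mult norm_triangle_ineq)
  also have "\<dots> \<le> cmod (1 - lam / X) + 1 * cmod (1 - X)"
    using False legendre_regionD(2)[OF assms(1)]
    by (intro add_mono mult_right_mono) (auto simp: norm_divide divide_le_eq)
  finally show ?thesis using legendre_regionD(7)[OF assms(1)] by simp
qed

text \<open>Bounding both factors by the triangle inequality alone would give (|X| - 1)^2 / |X|,
  whose inverse square root is not integrable at |X| = 1. The second identity shows that one factor
  stays away from 0, so only one power of |X| - 1 is lost.\<close>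

lemma factors_tail_ge:
  fixes lam X :: complex
  assumes "lam \<in> legendre_region" "1 < cmod X"
  shows "(cmod X - 1) / 4 \<le> cmod (1 - lam / X) * cmod (1 - X)"
proof -
  have X: "X \<noteq> 0" using assms by auto
  note r = legendre_regionD[OF assms(1)]
  have "1 - lam = (1 - lam / X) + (lam / X) * (1 - X)" using X by (simp add: field_simps)
  then have "cmod (1 - lam) \<le> cmod (1 - lam / X) + cmod (lam / X) * cmod (1 - X)"
    by (metis norm_mult norm_triangle_ineq)
  also have "\<dots> \<le> cmod (1 - lam / X) + 1 / cmod X * cmod (1 - X)"
    using assms r by (intro add_mono mult_right_mono) (auto simp: norm_divide divide_right_mono)
  finally have s: "1/2 \<le> cmod (1 - lam / X) + cmod (1 - X) / cmod X" using r(7) by (simp add: field_simps)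
  have q: "cmod X - 1 \<le> cmod (1 - X)" by (metis norm_minus_commute norm_one norm_triangle_ineq2)
  have "1 - cmod lam / cmod X \<le> cmod (1 - lam / X)"
    by (metis norm_divide norm_one norm_triangle_ineq2)
  moreover have "cmod lam / cmod X \<le> 1 / cmod X" using r(2) assms by (simp add: divide_right_mono)
  ultimately have p: "(cmod X - 1) / cmod X \<le> cmod (1 - lam / X)"
    using assms by (simp add: diff_divide_distrib)
  show ?thesis
  proof (cases "1/4 \<le> cmod (1 - lam / X)")
    case True
    then have "1/4 * (cmod X - 1) \<le> cmod (1 - lam / X) * cmod (1 - X)"
      using q assms by (intro mult_mono) auto
    then show ?thesis by simp
  next
    case False
    then have "1/4 \<le> cmod (1 - X) / cmod X" using s by linarith
    then have "cmod X / 4 \<le> cmod (1 - X)" using assms X by (simp add: field_simps)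
    then have "(cmod X - 1) / cmod X * (cmod X / 4) \<le> cmod (1 - lam / X) * cmod (1 - X)"
      using p assms by (intro mult_mono) auto
    then show ?thesis using X by simp
  qed
qed

text \<open>One of \<open>p\<close> and \<open>q\<close> is at least 1/4, so only the singularity of
  the other one remains: two inverse square roots never multiply to a non-integrable
  singularity.\<close>

lemma inverse_sqrt_product_le:
  fixes p q :: real
  assumes "0 < p'" "p' \<le> p" "0 < q'" "q' \<le> q" "1/2 \<le> p + q"
  shows "1 / sqrt (p * q) \<le> 2 * max (1 / sqrt p') (1 / sqrt q')"
proof -
  have *: "1 / sqrt (p * q) \<le> 2 * (1 / sqrt p')" if "0 < p'" "p' \<le> p" "1/4 \<le> q" for p p' q :: real
  proof -
    have "p' * (1/4) \<le> p * q" using that by (intro mult_mono) auto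
    then have "sqrt (p' * (1/4)) \<le> sqrt (p * q)" by (rule real_sqrt_le_mono)
    moreover have "sqrt (p' * (1/4)) = sqrt p' / 2" by (simp add: real_sqrt_divide)
    ultimately have "sqrt p' / 2 \<le> sqrt (p * q)" by argo
    moreover have "sqrt p' > 0" "sqrt (p * q) > 0" using that by auto
    ultimately have "1 / sqrt (p * q) \<le> 1 / (sqrt p' / 2)"
      by (intro divide_left_mono) auto
    then show ?thesis by simp
  qed
  show ?thesis
  proof (cases "1/4 \<le> q")
    case True
    show ?thesis using *[OF assms(1,2) True] by linarith
  next
    case False
    then have "1/4 \<le> p" using assms by simp
    from *[OF assms(3,4) this] show ?thesis by (simp add: mult.commute)
  qed
qed

text \<open>Factor 1 - P as a difference of squares; the principal root has real part at least 0,
  hence |1 + \<open>csqrt P\<close>| \<ge> 1.\<close>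

lemma cmod_inverse_csqrt_minus_one_le:
  assumes "P \<noteq> 0"
  shows "cmod (1 / csqrt P - 1) \<le> cmod (1 - P) * (1 / sqrt (cmod P))"
proof -
  have r: "1 \<le> cmod (1 + csqrt P)"
    using complex_Re_le_cmod[of "1 + csqrt P"] Re_csqrt[of P] by (simp del: csqrt.sel)
  have "1 - P = (1 - csqrt P) * (1 + csqrt P)" 
    by (simp add: algebra_simps flip: power2_eq_square)
  then have "cmod (1 - P) = cmod (1 - csqrt P) * cmod (1 + csqrt P)" by (simp add: norm_mult)
  then have "cmod (1 - csqrt P) \<le> cmod (1 - P)"
    using r mult_left_mono[OF r, of "cmod (1 - csqrt P)"] by simp
  moreover have "cmod (1 / csqrt P - 1) = cmod (1 - csqrt P) / sqrt (cmod P)"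
    using assms by (simp add: norm_divide[symmetric] divide_simps flip: norm_csqrt)
  ultimately show ?thesis by (simp add: divide_right_mono)
qed

lemma inverse_csqrt_product_minus_one_le:
  fixes lam X :: complex
  defines "x \<equiv> cmod X" and "u \<equiv> cmod (lam / X)"
  assumes "lam \<in> legendre_region" "X \<noteq> 0" "x < 1" "u < 1"
  shows "cmod (1 / (csqrt (1 - lam / X) * csqrt (1 - X)) - 1)
    \<le> 2 * (u / sqrt (1 - u)) + 3 * (x / sqrt (1 - x))"
proof -
  let ?P = "1 - lam / X" and ?Q = "1 - X"
  have P: "1 - u \<le> cmod ?P" "0 < 1 - u" and Q: "1 - x \<le> cmod ?Q" "0 < 1 - x"
    using assms by (metis norm_one norm_triangle_ineq2, simp, metis norm_one norm_triangle_ineq2, simp)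
  have nz: "?P \<noteq> 0" "?Q \<noteq> 0" using P Q by auto
  have pos: "0 \<le> x" "0 \<le> u" by (simp_all add: x_def u_def)
  define p where "p = 1 / sqrt (cmod ?P)"
  define q where "q = 1 / sqrt (cmod ?Q)"
  define p' where "p' = 1 / sqrt (1 - u)"
  define q' where "q' = 1 / sqrt (1 - x)"
  have "cmod (1 / (csqrt ?P * csqrt ?Q) - 1)
      = cmod ((1 / csqrt ?P - 1) * (1 / csqrt ?Q) + (1 / csqrt ?Q - 1))"
    using nz by (simp add: divide_simps) (simp add: algebra_simps)
  also have "\<dots> \<le> cmod (1 / csqrt ?P - 1) * cmod (1 / csqrt ?Q) + cmod (1 / csqrt ?Q - 1)"
    by (metis norm_mult norm_triangle_ineq)
  also have "\<dots> \<le> (u * p) * q + x * q"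
    using cmod_inverse_csqrt_minus_one_le[OF nz(1)] cmod_inverse_csqrt_minus_one_le[OF nz(2)]
    by (intro add_mono mult_mono) (auto simp: p_def q_def u_def x_def norm_divide)
  also have "\<dots> = u * (1 / sqrt (cmod ?P * cmod ?Q)) + x * q"
    by (simp add: p_def q_def real_sqrt_mult)
  also have "\<dots> \<le> u * (2 * max p' q') + x * q'"
  proof (intro add_mono mult_left_mono pos)
    show "1 / sqrt (cmod ?P * cmod ?Q) \<le> 2 * max p' q'"
      unfolding p'_def q'_def
      by (rule inverse_sqrt_product_le) (use P Q factors_sum_ge[OF assms(3,4)] in auto)
    show "q \<le> q'" unfolding q_def q'_def using Q nz by (intro divide_left_mono) auto
  qed
  \<comment> \<open>The larger of \<open>u\<close> and \<open>x\<close> belongs to the larger of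
    \<open>p'\<close> and \<open>q'\<close>. So if the maximum is \<open>q'\<close>, the factor
    \<open>u\<close> may be replaced by \<open>x\<close>.\<close>
  also have "u * (2 * max p' q') \<le> 2 * (u * p' + x * q')"
  proof -
    have "0 \<le> p'" "0 \<le> q'" using P Q by (auto simp: p'_def q'_def)
    moreover have "u * q' \<le> x * q'" if "u \<le> x" using that calculation by (intro mult_right_mono)
    moreover have "u * q' \<le> u * p'" if "x \<le> u"
      using that P Q pos unfolding p'_def q'_def by (intro mult_left_mono divide_left_mono) auto
    ultimately have "u * max p' q' \<le> u * p' + x * q'"
      using pos by (cases "u \<le> x"; cases "p' \<le> q'") (auto simp: max_def add_increasing add_increasing2)
    then show ?thesis by simp
  qed
  finally show ?thesis by (simp add: p'_def q'_def algebra_simps)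
qed

text \<open>The distance from 1 to the line through 0 at angle \<open>u\<close> is |sin u|, and the
  distance to the ray is at least 1 when cos u \<le> 0. Angles up to 3 pi / 2 occur as imaginary
  parts of \<open>c - w\<close>, and 5 exceeds 3 pi / 2.\<close>

lemma cmod_one_minus_cis_ge:
  fixes \<rho> u :: real
  assumes "0 \<le> \<rho>" "\<bar>u\<bar> \<le> 3 * pi / 2"
  shows "\<bar>u\<bar> / 5 \<le> cmod (1 - of_real \<rho> * cis u)"
proof -
  have re: "1 - \<rho> * cos u \<le> cmod (1 - of_real \<rho> * cis u)"
    using complex_Re_le_cmod[of "1 - of_real \<rho> * cis u"] by simp
  have sq: "(sin u)\<^sup>2 \<le> (cmod (1 - of_real \<rho> * cis u))\<^sup>2"
  proof -
    have "(cmod (1 - of_real \<rho> * cis u))\<^sup>2 = (1 - \<rho> * cos u)\<^sup>2 + (\<rho> * sin u)\<^sup>2"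
      by (simp add: cmod_power2)
    also have "\<dots> = (\<rho> - cos u)\<^sup>2 + (sin u)\<^sup>2 + (1 - (sin u)\<^sup>2 - (cos u)\<^sup>2) 
        + \<rho>\<^sup>2 * ((sin u)\<^sup>2 + (cos u)\<^sup>2 - 1)"
      by (simp only: power2_eq_square) algebra
    also have "\<dots> = (\<rho> - cos u)\<^sup>2 + (sin u)\<^sup>2" by (simp add: cos_squared_eq)
    finally show ?thesis by simp
  qed
  then have sn: "\<bar>sin u\<bar> \<le> cmod (1 - of_real \<rho> * cis u)"
    using power2_le_imp_le[of "\<bar>sin u\<bar>"] by simp
  show ?thesis
  proof (cases "\<bar>u\<bar> < pi/2")
    case True
    have "\<bar>u\<bar> / 5 \<le> \<bar>sin u\<bar>"
    proof -
      \<comment> \<open>Up to pi/3 the cosine is at least 1/2, so the sine is at least v/2; beyond,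
        the sine is at least 1/2 while v/5 is less than 4/10.\<close>
      have *: "v / 5 \<le> sin v" if v: "0 \<le> v" "v < pi/2" for v :: real
      proof (cases "v \<le> pi/3")
        case True
        have "(\<lambda>x. sin x - x/2) 0 \<le> (\<lambda>x. sin x - x/2) v"
        proof (rule DERIV_nonneg_imp_nondecreasing[OF v(1)])
          fix x assume x: "0 \<le> x" "x \<le> v"
          have "cos (pi/3) \<le> cos x" using x True by (intro cos_monotone_0_pi_le) auto
          then show "\<exists>y. ((\<lambda>x. sin x - x/2) has_real_derivative y) (at x) \<and> 0 \<le> y"
            by (intro exI[of _ "cos x - 1/2"]) (auto intro!: derivative_eq_intros simp: cos_60)
        qed
        then show ?thesis using v by simp
      next
        case False
        have "sin (pi/6) \<le> sin v" using False v by (intro sin_monotone_2pi_le) auto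
        then show ?thesis using v pi_less_4 by (simp add: sin_30)
      qed
      show ?thesis
        using *[of "\<bar>u\<bar>"] True by (cases "u \<ge> 0") auto
    qed
    then show ?thesis using sn by simp
  next
    case False
    have "cos \<bar>u\<bar> \<le> 0"
    proof (cases "\<bar>u\<bar> \<le> pi")
      case True
      then show ?thesis using False cos_monotone_0_pi_le[of "pi/2" "\<bar>u\<bar>"] by simp
    next
      case f: False
      have "cos \<bar>u\<bar> = - cos (\<bar>u\<bar> - pi)" by simp
      moreover have "0 \<le> cos (\<bar>u\<bar> - pi)" using f assms by (intro cos_ge_zero) auto
      ultimately show ?thesis by simp
    qed
    then have "\<rho> * cos u \<le> 0" using assms by (simp add: mult_nonneg_nonpos)
    then have "1 \<le> cmod (1 - of_real \<rho> * cis u)" using re by simp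
    then show ?thesis using assms pi_less_4 pi_approx by simp
  qed
qed

lemma cmod_one_minus_exp_ge:
  assumes "\<bar>Im w\<bar> \<le> 3 * pi / 2"
  shows "\<bar>Im w\<bar> / 5 \<le> cmod (1 - exp w)"
proof -
  have "exp w = of_real (exp (Re w)) * cis (Im w)" by (simp add: exp_eq_polar)
  then show ?thesis using cmod_one_minus_cis_ge[of "exp (Re w)" "Im w"] assms by simp
qed

section \<open>A strip with two horizontal slits\<close>

text \<open>The part below Im w = pi is the image of \<open>slit_plane lam\<close> under
  \<open>Ln\<close> when \<open>c = Ln lam\<close>: the cut from 1 to infinity becomes the
  right-hand slit, the segment from 0 to \<open>lam\<close> the left-hand one. The extra height 1
  turns the upper side of the negative axis into an interior line.\<close>

definition slit_strip :: "complex \<Rightarrow> complex set" where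
  "slit_strip c = {w. - pi < Im w \<and> Im w < pi + 1 \<and>
     \<not> (Im w = 0 \<and> 0 \<le> Re w) \<and> \<not> (Im w = Im c \<and> Re w \<le> Re c)}"

text \<open>The slope of this line is chosen so that it passes between the two slits even if \<open>Re c = 0\<close>.\<close>

definition transversal :: "complex \<Rightarrow> real \<Rightarrow> complex" where
  "transversal c t = c / 2 + of_real (t - Im c / 2) * Complex (Im c / 16) 1"

lemma Im_transversal [simp]: "Im (transversal c t) = t"
  by (simp add: transversal_def)

lemma Re_transversal: "Re (transversal c t) = Re c / 2 + (t - Im c / 2) * (Im c / 16)"
  by (simp add: transversal_def)

text \<open>Only the heights 0 and \<open>Im c\<close> matter. There the slope moves the real part
  from \<open>Re c / 2\<close> by (Im c)^2 / 32 away from the slit, and one of \<open>Re c\<close>,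
  \<open>Im c\<close> is nonzero.\<close>

lemma transversal_in_slit_strip:
  assumes "Re c \<le> 0" "c \<noteq> 0" "- pi < t" "t < pi + 1"
  shows "transversal c t \<in> slit_strip c"
proof -
  have "Re c < 0 \<or> 0 < Im c * Im c"
    using assms by (auto simp: complex_eq_iff)
  moreover have "0 \<le> Im c * Im c" by simp
  ultimately have "Re c / 2 - Im c * Im c / 32 < 0" "Re c < Re c / 2 + Im c * Im c / 32"
    using assms by argo+
  then show ?thesis using assms by (auto simp: slit_strip_def Re_transversal)
qed

lemma horizontal_segment_slit_strip:
  assumes "w \<in> slit_strip c" "w' \<in> slit_strip c" "Im w = Im w'"
  shows "closed_segment w w' \<subseteq> slit_strip c"
proof
  fix v assume "v \<in> closed_segment w w'"
  then obtain s where s: "0 \<le> s" "s \<le> 1" "v = (1 - s) *\<^sub>R w + s *\<^sub>R w'" by (auto simp: in_segment)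
  have "Im v = (1 - s) * Im w + s * Im w'" by (simp add: s(3))
  then have Im: "Im v = Im w" using assms by (simp add: algebra_simps)
  have Re: "Re v \<in> closed_segment (Re w) (Re w')" using s by (auto simp: in_segment)
  show "v \<in> slit_strip c"
    using assms Im Re by (auto simp: slit_strip_def closed_segment_eq_real_ivl split: if_splits)
qed

lemma open_slit_strip: "open (slit_strip c)"
proof -
  have eq: "slit_strip c = {w. - pi < Im w} \<inter> {w. Im w < pi + 1} \<inter>
      - ({w. Im w = 0} \<inter> {w. 0 \<le> Re w}) \<inter> - ({w. Im w = Im c} \<inter> {w. Re w \<le> Re c})"
    by (auto simp: slit_strip_def)
  show ?thesis unfolding eq
    by (intro open_Int open_Compl closed_Int open_Collect_less closed_Collect_le closed_Collect_eq
        continuous_intros)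
qed

text \<open>The transversal meets every height, and each point reaches it horizontally, because the
  strip cuts every horizontal line in a single interval.\<close>

lemma connected_slit_strip:
  assumes "Re c \<le> 0" "c \<noteq> 0"
  shows "connected (slit_strip c)"
proof -
  let ?S = "slit_strip c" and ?p = "transversal c"
  have 1: "connected_component ?S w (?p (Im w))" if "w \<in> ?S" for w
  proof -
    have "?p (Im w) \<in> ?S"
      using that by (intro transversal_in_slit_strip assms) (auto simp: slit_strip_def)
    then show ?thesis
      unfolding connected_component_def using horizontal_segment_slit_strip[OF that, of "?p (Im w)"]
      by (intro exI[of _ "closed_segment w (?p (Im w))"]) auto
  qed
  have 2: "connected_component ?S (?p s) (?p t)" if "s \<in> {-pi<..<pi+1}" "t \<in> {-pi<..<pi+1}" for s t
  proof -
    have "connected (?p ` {-pi<..<pi+1})"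
      unfolding transversal_def by (intro connected_continuous_image continuous_intros) auto
    moreover have "?p ` {-pi<..<pi+1} \<subseteq> ?S" using transversal_in_slit_strip[OF assms] by auto
    ultimately show ?thesis using that unfolding connected_component_def by blast
  qed
  show ?thesis
    unfolding connected_iff_connected_component
  proof (intro ballI)
    fix w v assume "w \<in> ?S" "v \<in> ?S"
    then show "connected_component ?S w v"
      using 1[of w] 1[of v] 2[of "Im w" "Im v"]
      by (smt (verit, ccfv_threshold) slit_strip_def mem_Collect_eq greaterThanLessThan_iff
          connected_component_trans connected_component_sym)
  qed
qed

lemma not_bounded_halfplane_or_ray:
  "\<not> bounded {w. Im w \<le> b}" "\<not> bounded {w. b \<le> Im w}"
  "\<not> bounded {w. Im w = b \<and> a \<le> Re w}" "\<not> bounded {w. Im w = b \<and> Re w \<le> a}"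
proof -
  have *: "\<not> bounded A" if "\<And>t. 0 \<le> t \<Longrightarrow> p + of_real t * q \<in> A" "q \<noteq> 0" for A and p q :: complex
  proof
    assume "bounded A"
    then obtain B where B: "\<And>x. x \<in> A \<Longrightarrow> cmod x \<le> B" by (auto simp: bounded_iff)
    have "0 \<le> B" using B[OF that(1)[of 0]] norm_ge_zero order_trans by blast
    define t where "t = (B + cmod p + 1) / cmod q"
    have t: "0 \<le> t" "t * cmod q = B + cmod p + 1" using \<open>0 \<le> B\<close> that(2) by (auto simp: t_def)
    have "cmod (of_real t * q) \<le> cmod (p + of_real t * q) + cmod p"
      by (metis add_diff_cancel_left' norm_triangle_sub add.commute norm_triangle_ineq4)
    then show False using B[OF that(1)[OF t(1)]] t by (simp add: norm_mult)
  qed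
  show "\<not> bounded {w. Im w \<le> b}" by (rule *[of "Complex 0 b" "- \<i>"]) auto
  show "\<not> bounded {w. b \<le> Im w}" by (rule *[of "Complex 0 b" "\<i>"]) auto
  show "\<not> bounded {w. Im w = b \<and> a \<le> Re w}" by (rule *[of "Complex a b" 1]) auto
  show "\<not> bounded {w. Im w = b \<and> Re w \<le> a}" by (rule *[of "Complex a b" "-1"]) auto
qed

text \<open>Every point of the complement lies in a half-plane or a ray contained in the complement.
  These sets are connected and unbounded, so no component of the complement is bounded.\<close>

lemma simply_connected_slit_strip:
  assumes "Re c \<le> 0" "c \<noteq> 0"
  shows "simply_connected (slit_strip c)"
proof -
  have "\<not> bounded C" if C: "C \<in> components (- slit_strip c)" for C
  proof -
    have *: "\<not> bounded C" if "connected A" "A \<subseteq> - slit_strip c" "\<not> bounded A" "v \<in> A" "v \<in> C" for A v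
      using components_maximal[OF C that(1,2)] that bounded_subset by blast
    obtain v where v: "v \<in> C" using in_components_nonempty[OF C] by auto
    then have "v \<notin> slit_strip c" using in_components_subset[OF C] by auto
    then consider "Im v \<le> - pi" | "pi + 1 \<le> Im v" | "Im v = 0 \<and> 0 \<le> Re v" | "Im v = Im c \<and> Re v \<le> Re c"
      by (auto simp: slit_strip_def)
    then show ?thesis
    proof cases
      case 1
      show ?thesis
        by (rule *[of "{w. Im w \<le> - pi}" v])
           (use 1 v not_bounded_halfplane_or_ray(1) in \<open>auto simp: slit_strip_def
             intro!: convex_connected convex_halfspace_Im_le\<close>)
    next
      case 2
      show ?thesis
        by (rule *[of "{w. pi + 1 \<le> Im w}" v])
           (use 2 v not_bounded_halfplane_or_ray(2) in \<open>auto simp: slit_strip_def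
             intro!: convex_connected convex_halfspace_Im_ge\<close>)
    next
      case 3
      have "convex ({w. Im w \<le> 0} \<inter> {w. Im w \<ge> 0} \<inter> {w. Re w \<ge> 0})"
        by (intro convex_Int convex_halfspace_Im_le convex_halfspace_Im_ge convex_halfspace_Re_ge)
      moreover have "{w. Im w \<le> 0} \<inter> {w. Im w \<ge> 0} \<inter> {w. Re w \<ge> 0} = {w. Im w = 0 \<and> 0 \<le> Re w}" by auto
      ultimately show ?thesis
        using *[of "{w. Im w = 0 \<and> 0 \<le> Re w}" v] 3 v not_bounded_halfplane_or_ray(3)[of 0 0]
        by (auto simp: slit_strip_def convex_connected)
    next
      case 4
      have "convex ({w. Im w \<le> Im c} \<inter> {w. Im w \<ge> Im c} \<inter> {w. Re w \<le> Re c})"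
        by (intro convex_Int convex_halfspace_Im_le convex_halfspace_Im_ge convex_halfspace_Re_le)
      moreover have "{w. Im w \<le> Im c} \<inter> {w. Im w \<ge> Im c} \<inter> {w. Re w \<le> Re c} = {w. Im w = Im c \<and> Re w \<le> Re c}" by auto
      ultimately show ?thesis
        using *[of "{w. Im w = Im c \<and> Re w \<le> Re c}" v] 4 v not_bounded_halfplane_or_ray(4)[of "Im c" "Re c"]
        by (auto simp: slit_strip_def convex_connected)
    qed
  qed
  then show ?thesis
    using assms by (simp add: simply_connected_eq_unbounded_complement_components
        open_slit_strip connected_slit_strip)
qed

section \<open>The logarithmic form of the elliptic differential\<close>

text \<open>Two separate principal roots are taken because the cut of each factor is then exactly
  one slit of the strip; the cut of the root of the product need not be straight for non-real
  \<open>lam\<close>.\<close>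

definition log_form :: "complex \<Rightarrow> complex \<Rightarrow> complex" where
  "log_form lam w = 1 / (2 * \<i> * csqrt (1 - lam / exp w) * csqrt (1 - exp w))"

lemma cmod_log_form:
  "cmod (log_form lam w) = 1/2 * (1 / sqrt (cmod (1 - lam / exp w) * cmod (1 - exp w)))"
  by (simp add: log_form_def norm_divide norm_mult real_sqrt_mult)

locale legendre_param =
  fixes lam :: complex
  assumes lam: "lam \<in> legendre_region"
begin

abbreviation "c \<equiv> Ln lam"

lemma exp_c [simp]: "exp c = lam"
  using legendre_regionD(1)[OF lam] by simp

lemma Re_c: "Re c \<le> 0"
  using legendre_regionD(1,2)[OF lam] by simp

lemma c_nonzero: "c \<noteq> 0"
proof
  assume "c = 0"
  then have "lam = 1" using exp_c by simp
  then show False using lam by (simp add: legendre_region_def)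
qed

lemma Im_c: "\<bar>Im c\<bar> < pi / 2"
  using Re_Ln_pos_lt[of lam] legendre_regionD(1,4)[OF lam] by simp

lemma lam_over_exp: "lam / exp w = exp (c - w)"
  by (simp add: exp_diff)

lemma cmod_lam_over_exp: "cmod (lam / exp w) = exp (Re c - Re w)"
  unfolding lam_over_exp by simp

text \<open>If 1 - exp v is a nonpositive real, then exp v is real and at least 1, so
  \<open>Im v\<close> is a multiple of 2 pi, and it vanishes if it is less than 2 pi in absolute
  value. This applies to \<open>w\<close> for the right slit and to \<open>c - w\<close> for the
  left one.\<close>

lemma factors_slit_strip:
  assumes "w \<in> slit_strip c"
  shows "1 - exp w \<notin> \<real>\<^sub>\<le>\<^sub>0" "1 - lam / exp w \<notin> \<real>\<^sub>\<le>\<^sub>0"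
proof -
  have *: "Im v = 0 \<and> 0 \<le> Re v" if "1 - exp v \<in> \<real>\<^sub>\<le>\<^sub>0" "\<bar>Im v\<bar> < 2 * pi" for v
  proof -
    obtain y where y: "1 - exp v = of_real y" "y \<le> 0" using \<open>1 - exp v \<in> _\<close> by (auto elim: nonpos_Reals_cases)
    then have "exp v = of_real (1 - y)" by (simp add: algebra_simps)
    also have "\<dots> = exp (of_real (ln (1 - y)))" using y by (simp add: exp_of_real)
    finally obtain n :: int where "v = of_real (ln (1 - y)) + (of_int (2 * n) * pi) * \<i>"
      unfolding exp_eq by auto
    then have v: "Im v = of_int n * (2 * pi)" "Re v = ln (1 - y)" by auto
    have "\<bar>of_int n\<bar> * (2 * pi) < 1 * (2 * pi)" using that v by (simp add: abs_mult)
    then have "\<bar>real_of_int n\<bar> < 1" by (subst (asm) mult_less_cancel_right) auto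
    then have "n = 0" by linarith
    then show ?thesis using v y by simp
  qed
  have pi: "pi > 3" using pi_approx by simp
  \<comment> \<open>The strip is low enough for both arguments: |Im (c - w)| < pi + 1 + pi/2 < 2
    pi.\<close>
  have "- pi < Im w" "Im w < pi + 1" using assms by (auto simp: slit_strip_def)
  then have "\<bar>Im w\<bar> < 2 * pi" "\<bar>Im (c - w)\<bar> < 2 * pi" using pi Im_c by simp_all
  note * = *[OF _ this(1)] *[OF _ this(2)]
  show "1 - exp w \<notin> \<real>\<^sub>\<le>\<^sub>0"
    using *(1) assms by (auto simp: slit_strip_def)
  show "1 - lam / exp w \<notin> \<real>\<^sub>\<le>\<^sub>0"
    unfolding lam_over_exp using *(2) assms by (auto simp: slit_strip_def)
qed

lemma holomorphic_log_form: "log_form lam holomorphic_on slit_strip c"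
  unfolding log_form_def
  by (intro holomorphic_intros) (use factors_slit_strip in force)+

lemma log_form_right:
  assumes "0 < Re w"
  shows "cmod (log_form lam w) \<le> 1 / sqrt (exp (Re w) - 1)"
proof -
  have "(exp (Re w) - 1) / 4 \<le> cmod (1 - lam / exp w) * cmod (1 - exp w)"
    using factors_tail_ge[OF lam, of "exp w"] assms by simp
  then have "sqrt ((exp (Re w) - 1) / 4) \<le> sqrt (cmod (1 - lam / exp w) * cmod (1 - exp w))"
    by (rule real_sqrt_le_mono)
  moreover have "sqrt ((exp (Re w) - 1) / 4) = sqrt (exp (Re w) - 1) / 2" by (simp add: real_sqrt_divide)
  ultimately have *: "sqrt (exp (Re w) - 1) / 2 \<le> sqrt (cmod (1 - lam / exp w) * cmod (1 - exp w))" by argo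
  moreover have "0 < sqrt (exp (Re w) - 1)" using assms by simp
  ultimately have "1 / sqrt (cmod (1 - lam / exp w) * cmod (1 - exp w)) \<le> 1 / (sqrt (exp (Re w) - 1) / 2)"
    by (intro frac_le) simp_all
  then show ?thesis by (simp add: cmod_log_form)
qed

text \<open>The reflection \<open>w \<mapsto> c - w\<close> swaps the two factors.\<close>

lemma log_form_reflect: "log_form lam (c - w) = log_form lam w"
  using legendre_regionD(1)[OF lam] by (simp add: log_form_def exp_diff)

lemma log_form_left:
  assumes "Re w < Re c"
  shows "cmod (log_form lam w) \<le> 1 / sqrt (exp (Re c - Re w) - 1)"
  using log_form_right[of "c - w"] assms by (simp add: log_form_reflect)

lemma log_form_minus_const:
  assumes "w \<in> slit_strip c"
  shows "log_form lam w - 1 / (2 * \<i>) =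
    1 / (2 * \<i>) * (1 / (csqrt (1 - lam / exp w) * csqrt (1 - exp w)) - 1)"
  using factors_slit_strip[OF assms] by (auto simp: log_form_def divide_simps)

lemma cmod_inverse_two_i: "cmod (1 / (2 * \<i>)) = 1/2"
  by (simp add: norm_divide norm_mult)

lemma log_form_middle:
  assumes "w \<in> slit_strip c" "Re c < Re w" "Re w < 0"
  shows "cmod (log_form lam w - 1 / (2 * \<i>)) \<le>
    exp (Re c - Re w) / sqrt (1 - exp (Re c - Re w)) + 3/2 * (exp (Re w) / sqrt (1 - exp (Re w)))"
proof -
  have "cmod (1 / (csqrt (1 - lam / exp w) * csqrt (1 - exp w)) - 1) \<le>
      2 * (exp (Re c - Re w) / sqrt (1 - exp (Re c - Re w))) + 3 * (exp (Re w) / sqrt (1 - exp (Re w)))"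
    using inverse_csqrt_product_minus_one_le[OF lam, of "exp w"] assms
    unfolding cmod_lam_over_exp by simp
  then show ?thesis
    unfolding log_form_minus_const[OF assms(1)] norm_mult cmod_inverse_two_i by argo
qed

text \<open>The bound depends on the height alone, so a crossing is controlled however close it
  comes to the branch points; its singularities at heights 0 and \<open>Im c\<close> are integrable.
  The \<open>sqrt 5\<close> stems from the 1/5 in \<open>cmod_one_minus_exp_ge\<close>.\<close>

lemma log_form_vertical:
  assumes "\<bar>Im w\<bar> \<le> pi" "Im w \<noteq> 0" "Im w \<noteq> Im c"
  shows "cmod (log_form lam w) \<le> sqrt 5 * (1 / sqrt \<bar>Im w\<bar> + 1 / sqrt \<bar>Im w - Im c\<bar>)"
proof -
  have p: "\<bar>Im w - Im c\<bar> / 5 \<le> cmod (1 - lam / exp w)"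
  proof -
    have "\<bar>Im (c - w)\<bar> \<le> 3 * pi / 2"
      unfolding minus_complex.sel using assms(1) Im_c by linarith
    from cmod_one_minus_exp_ge[OF this] show ?thesis
      unfolding lam_over_exp minus_complex.sel by (simp only: abs_minus_commute)
  qed
  have q: "\<bar>Im w\<bar> / 5 \<le> cmod (1 - exp w)"
    using cmod_one_minus_exp_ge[of w] assms by simp
  have "1 / sqrt (cmod (1 - lam / exp w) * cmod (1 - exp w)) \<le>
      2 * max (1 / sqrt (\<bar>Im w - Im c\<bar> / 5)) (1 / sqrt (\<bar>Im w\<bar> / 5))"
    by (rule inverse_sqrt_product_le) (use p q assms factors_sum_ge[OF lam, of "exp w"] in auto)
  also have "\<dots> \<le> 2 * (1 / sqrt (\<bar>Im w - Im c\<bar> / 5) + 1 / sqrt (\<bar>Im w\<bar> / 5))"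
    by (intro mult_left_mono) (simp_all add: max_def)
  finally show ?thesis by (simp add: cmod_log_form real_sqrt_divide algebra_simps)
qed

text \<open>On this line X is negative, so both factors have modulus at least 1 as
  \<open>Re lam\<close> is positive. The form is free of singularities there, which gives much
  smaller constants than on a general horizontal line. The three bounds serve the right, left and
  middle range.\<close>

lemma log_form_top:
  assumes "w \<in> slit_strip c" "Im w = pi"
  shows "cmod (log_form lam w) \<le> exp (- Re w / 2) / 2"
    and "cmod (log_form lam w) \<le> exp ((Re w - Re c) / 2) / 2"
    and "cmod (log_form lam w - 1 / (2 * \<i>)) \<le> (exp (Re w) + exp (Re c - Re w)) / 2"
proof -
  define t where "t = exp (Re w)"
  have t: "t > 0" by (simp add: t_def)
  have X: "exp w = - of_real t" unfolding t_def exp_eq_polar assms by simp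
  have u: "exp (Re c - Re w) = cmod lam / t"
    using legendre_regionD(1)[OF lam] by (simp add: exp_diff t_def)
  have "1 - exp w = of_real (1 + t)" unfolding X by simp
  then have Q: "cmod (1 - exp w) = 1 + t" using t by (simp only: norm_of_real)
  have Re_pos: "0 < Re lam" using legendre_regionD(4)[OF lam] .
  have P1: "1 \<le> cmod (1 - lam / exp w)"
  proof -
    have "0 \<le> Re lam / t" using Re_pos t by simp
    then show ?thesis
      using complex_Re_le_cmod[of "1 - lam / exp w"] unfolding X by (simp add: Re_divide_of_real)
  qed
  have P2: "exp (Re c - Re w) \<le> cmod (1 - lam / exp w)"
  proof -
    have "(cmod (lam / of_real t))\<^sup>2 \<le> (cmod (1 + lam / of_real t))\<^sup>2"
      unfolding cmod_power2 using Re_pos t by (simp add: power2_eq_square algebra_simps)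
    then show ?thesis using t by (simp add: u X norm_divide power2_le_iff_abs_le)
  qed
  have "sqrt t \<le> sqrt (cmod (1 - lam / exp w) * cmod (1 - exp w))"
    using mult_mono[OF P1, of t "cmod (1 - exp w)"] t by (intro real_sqrt_le_mono) (simp add: Q)
  then have "1 / sqrt (cmod (1 - lam / exp w) * cmod (1 - exp w)) \<le> 1 / sqrt t"
    using t by (intro divide_left_mono mult_pos_pos) (auto intro: less_le_trans[of _ "sqrt t"])
  also have "1 / sqrt t = exp (- Re w / 2)"
    unfolding t_def by (simp add: exp_minus field_simps flip: powr_half_sqrt) 
      (simp add: powr_def flip: exp_add)
  finally show "cmod (log_form lam w) \<le> exp (- Re w / 2) / 2" by (simp add: cmod_log_form)
  define s where "s = exp (Re c - Re w)"
  have s: "s > 0" by (simp add: s_def)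
  have "sqrt s \<le> sqrt (cmod (1 - lam / exp w) * cmod (1 - exp w))"
    using mult_mono[OF P2, of 1 "cmod (1 - exp w)"] t by (intro real_sqrt_le_mono) (simp add: Q s_def)
  then have "1 / sqrt (cmod (1 - lam / exp w) * cmod (1 - exp w)) \<le> 1 / sqrt s"
    using s by (intro divide_left_mono mult_pos_pos) (auto intro: less_le_trans[of _ "sqrt s"])
  also have "1 / sqrt s = exp ((Re w - Re c) / 2)"
    unfolding s_def by (simp add: field_simps flip: powr_half_sqrt) 
      (simp add: powr_def field_simps flip: exp_add)
  finally show "cmod (log_form lam w) \<le> exp ((Re w - Re c) / 2) / 2" by (simp add: cmod_log_form)
  have nz: "1 - lam / exp w \<noteq> 0" "1 - exp w \<noteq> 0" using P1 Q t by auto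
  have inv: "1 / sqrt (cmod (1 - lam / exp w)) \<le> 1" "1 / sqrt (cmod (1 - exp w)) \<le> 1"
    using frac_le[of 1 1 1 "sqrt (cmod (1 - lam / exp w))"] P1 Q t by auto
  have "cmod (1 / (csqrt (1 - lam / exp w) * csqrt (1 - exp w)) - 1)
      = cmod ((1 / csqrt (1 - lam / exp w) - 1) * (1 / csqrt (1 - exp w)) + (1 / csqrt (1 - exp w) - 1))"
    using nz by (simp add: divide_simps) (simp add: algebra_simps)
  also have "\<dots> \<le> cmod (1 / csqrt (1 - lam / exp w) - 1) * cmod (1 / csqrt (1 - exp w))
      + cmod (1 / csqrt (1 - exp w) - 1)"
    by (metis norm_mult norm_triangle_ineq)
  also have "\<dots> \<le> (cmod (lam / exp w) * 1) * 1 + cmod (exp w) * 1"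
    using inv order_trans[OF cmod_inverse_csqrt_minus_one_le[OF nz(1)] mult_left_mono[OF inv(1)]]
      order_trans[OF cmod_inverse_csqrt_minus_one_le[OF nz(2)] mult_left_mono[OF inv(2)]]
    by (intro add_mono mult_mono) (auto simp: norm_divide)
  finally have "cmod (1 / (csqrt (1 - lam / exp w) * csqrt (1 - exp w)) - 1)
      \<le> exp (Re c - Re w) + exp (Re w)"
    unfolding cmod_lam_over_exp by simp
  then show "cmod (log_form lam w - 1 / (2 * \<i>)) \<le> (exp (Re w) + exp (Re c - Re w)) / 2"
    unfolding log_form_minus_const[OF assms(1)] norm_mult cmod_inverse_two_i by argo
qed

end

section \<open>Growth of a primitive\<close>

text \<open>The additive constant of \<open>H\<close> is left open: only differences of
  \<open>H\<close> are estimated, and \<open>legendre_normalized\<close> fixes the constant.\<close>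

locale legendre_primitive = legendre_param +
  fixes H :: "complex \<Rightarrow> complex"
  assumes H: "w \<in> slit_strip c \<Longrightarrow> (H has_field_derivative log_form lam w) (at w)"
begin

lemma holomorphic_H: "H holomorphic_on slit_strip c"
proof (rule holomorphic_onI)
  fix w assume "w \<in> slit_strip c"
  from has_field_derivative_at_within[OF H[OF this]]
  show "H field_differentiable at w within slit_strip c" unfolding field_differentiable_def by (rule exI)
qed

lemma H_line_vector_derivative:
  assumes "v + of_real x * d \<in> slit_strip c"
  shows "((\<lambda>x. H (v + of_real x * d)) has_vector_derivative d * log_form lam (v + of_real x * d)) (at x)"
proof -
  have "((\<lambda>z. H (v + z * d)) has_field_derivative log_form lam (v + of_real x * d) * d) (at (of_real x))"
    by (rule DERIV_chain2[where f = H and g = "\<lambda>z. v + z * d", OF H[OF assms]])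
       (auto intro!: derivative_eq_intros)
  from has_vector_derivative_real_field[OF this] show ?thesis by (simp only: mult.commute)
qed

lemma horizontal_in_slit_strip:
  assumes "Complex a b \<in> slit_strip c" "Complex a' b \<in> slit_strip c" "a \<le> x" "x \<le> a'"
  shows "Complex x b \<in> slit_strip c"
  using assms by (auto simp: slit_strip_def)

lemma H_horizontal_vector_derivative:
  assumes "Complex x b \<in> slit_strip c"
  shows "((\<lambda>x. H (Complex x b)) has_vector_derivative log_form lam (Complex x b)) (at x)"
proof -
  have "Complex 0 b + of_real x * 1 = Complex x b" for x by (simp add: complex_eq_iff)
  then show ?thesis
    using H_line_vector_derivative[of "Complex 0 b" x 1] assms by (simp only: mult_1)
qed

lemma H_horizontal_continuous:
  assumes "Complex a b \<in> slit_strip c" "Complex a' b \<in> slit_strip c"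
  shows "continuous_on {a..a'} (\<lambda>x. H (Complex x b))"
proof (rule continuous_at_imp_continuous_on, rule ballI)
  fix x assume "x \<in> {a..a'}"
  then have "Complex x b \<in> slit_strip c" using horizontal_in_slit_strip[OF assms] by simp
  from has_vector_derivative_continuous[OF H_horizontal_vector_derivative[OF this]]
  show "isCont (\<lambda>x. H (Complex x b)) x" .
qed

text \<open>The majorants outside the annulus have \<open>2 * arctan\<close> of a nonnegative number
  as primitive up to sign, which varies by at most pi. In the middle, two roots with values in [0,1]
  and weights 2 and 3 vary by at most 5.\<close>

lemma H_horizontal_le:
  assumes "Complex a b \<in> slit_strip c" "Complex a' b \<in> slit_strip c" "a \<le> a'"
  shows "cmod (H (Complex a' b) - H (Complex a b) - of_real (clip (Re c) a' - clip (Re c) a) * (1 / (2 * \<i>)))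
    \<le> pi + 5 + pi"
proof (rule norm_diff_clip_le[where F = "\<lambda>x. H (Complex x b)" and F' = "\<lambda>x. log_form lam (Complex x b)"
      and gl = "\<lambda>x. - 2 * arctan (sqrt (exp (Re c - x) - 1))" and gl' = "\<lambda>x. 1 / sqrt (exp (Re c - x) - 1)"
      and gm = "\<lambda>x. 2 * sqrt (1 - exp (Re c - x)) - 3 * sqrt (1 - exp x)"
      and gm' = "\<lambda>x. exp (Re c - x) / sqrt (1 - exp (Re c - x)) + 3/2 * (exp x / sqrt (1 - exp x))"
      and gr = "\<lambda>x. 2 * arctan (sqrt (exp x - 1))" and gr' = "\<lambda>x. 1 / sqrt (exp x - 1)"])
  note in_S = horizontal_in_slit_strip[OF assms(1,2)]
  show "((\<lambda>x. H (Complex x b)) has_vector_derivative log_form lam (Complex x b)) (at x)"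
    if "x \<in> {a<..<a'}" for x
    using that by (intro H_horizontal_vector_derivative in_S) auto
  show "cmod (log_form lam (Complex x b)) \<le> 1 / sqrt (exp (Re c - x) - 1)" if "x < Re c" for x
    using log_form_left[of "Complex x b"] that by simp
  show "cmod (log_form lam (Complex x b)) \<le> 1 / sqrt (exp x - 1)" if "0 < x" for x
    using log_form_right[of "Complex x b"] that by simp
  show "cmod (log_form lam (Complex x b) - 1 / (2 * \<i>)) \<le>
      exp (Re c - x) / sqrt (1 - exp (Re c - x)) + 3/2 * (exp x / sqrt (1 - exp x))"
    if "x \<in> {a<..<a'}" "Re c < x" "x < 0" for x
    using log_form_middle[of "Complex x b"] in_S that by simp
  show "((\<lambda>x. - 2 * arctan (sqrt (exp (Re c - x) - 1))) has_real_derivative 1 / sqrt (exp (Re c - x) - 1)) (at x)"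
    if "x < Re c" for x
    using that by (auto intro!: derivative_eq_intros simp del: Re_Ln simp: field_simps)
  show "((\<lambda>x. 2 * arctan (sqrt (exp x - 1))) has_real_derivative 1 / sqrt (exp x - 1)) (at x)"
    if "0 < x" for x
    using that by (auto intro!: derivative_eq_intros simp: field_simps)
  show "((\<lambda>x. 2 * sqrt (1 - exp (Re c - x)) - 3 * sqrt (1 - exp x)) has_real_derivative
      exp (Re c - x) / sqrt (1 - exp (Re c - x)) + 3/2 * (exp x / sqrt (1 - exp x))) (at x)"
    if "Re c < x" "x < 0" for x
    using that by (auto intro!: derivative_eq_intros simp del: Re_Ln simp: field_simps)
  show "- 2 * arctan (sqrt (exp (Re c - x) - 1)) - - 2 * arctan (sqrt (exp (Re c - y) - 1)) \<le> pi"
    if "x \<le> Re c" "y \<le> Re c" for x y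
  proof -
    have "0 \<le> arctan (sqrt (exp (Re c - x) - 1))" using that by (simp add: zero_le_arctan_iff)
    then show ?thesis using arctan_ubound[of "sqrt (exp (Re c - y) - 1)"] by linarith
  qed
  show "2 * arctan (sqrt (exp x - 1)) - 2 * arctan (sqrt (exp y - 1)) \<le> pi"
    if "0 \<le> x" "0 \<le> y" for x y
  proof -
    have "0 \<le> arctan (sqrt (exp y - 1))" using that by (simp add: zero_le_arctan_iff)
    then show ?thesis using arctan_ubound[of "sqrt (exp x - 1)"] by linarith
  qed
  show "(2 * sqrt (1 - exp (Re c - x)) - 3 * sqrt (1 - exp x)) -
      (2 * sqrt (1 - exp (Re c - y)) - 3 * sqrt (1 - exp y)) \<le> 5"
    if "x \<in> {Re c..0}" "y \<in> {Re c..0}" for x y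
  proof -
    have "0 \<le> sqrt (1 - exp t)" "sqrt (1 - exp t) \<le> 1" if "t \<le> 0" for t :: real
      using that by auto
    from this[of "Re c - x"] this[of x] this[of "Re c - y"] this[of y] that show ?thesis
      unfolding atLeastAtMost_iff by linarith
  qed
  show "continuous_on {a..a'} (\<lambda>x. H (Complex x b))"
    by (rule H_horizontal_continuous[OF assms(1,2)])
qed (use assms(3) Re_c in \<open>auto intro!: continuous_intros\<close>)

lemma top_in_slit_strip: "Complex a pi \<in> slit_strip c"
  using Im_c by (auto simp: slit_strip_def)

lemma H_top_le:
  assumes "a \<le> a'"
  shows "cmod (H (Complex a' pi) - H (Complex a pi) - of_real (clip (Re c) a' - clip (Re c) a) * (1 / (2 * \<i>)))
    \<le> 1 + 1 + 1"
proof (rule norm_diff_clip_le[where F = "\<lambda>x. H (Complex x pi)" and F' = "\<lambda>x. log_form lam (Complex x pi)"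
      and gl = "\<lambda>x. exp ((x - Re c) / 2)" and gl' = "\<lambda>x. exp ((x - Re c) / 2) / 2"
      and gm = "\<lambda>x. (exp x - exp (Re c - x)) / 2" and gm' = "\<lambda>x. (exp x + exp (Re c - x)) / 2"
      and gr = "\<lambda>x. - exp (- x / 2)" and gr' = "\<lambda>x. exp (- x / 2) / 2"])
  show "exp ((x - Re c) / 2) - exp ((y - Re c) / 2) \<le> 1" if "x \<le> Re c" for x y
  proof -
    have "exp ((x - Re c) / 2) \<le> 1" using that by simp
    then show ?thesis using exp_ge_zero[of "(y - Re c) / 2"] by linarith
  qed
  show "(exp x - exp (Re c - x)) / 2 - (exp y - exp (Re c - y)) / 2 \<le> 1"
    if "x \<in> {Re c..0}" "y \<in> {Re c..0}" for x y
  proof -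
    have "exp x \<le> 1" "exp (Re c - y) \<le> 1" using that by auto
    then show ?thesis using exp_ge_zero[of y] exp_ge_zero[of "Re c - x"] by argo
  qed
  show "- exp (- x / 2) - - exp (- y / 2) \<le> 1" if "0 \<le> y" for x y :: real
  proof -
    have "exp (- y / 2) \<le> 1" using that by simp
    then show ?thesis using exp_ge_zero[of "- x / 2"] by argo
  qed
  show "cmod (log_form lam (Complex x pi)) \<le> exp ((x - Re c) / 2) / 2" for x
    using log_form_top(2)[OF top_in_slit_strip] by (simp del: Re_Ln)
  show "cmod (log_form lam (Complex x pi)) \<le> exp (- x / 2) / 2" for x
    using log_form_top(1)[OF top_in_slit_strip] by (simp del: Re_Ln)
  show "cmod (log_form lam (Complex x pi) - 1 / (2 * \<i>)) \<le> (exp x + exp (Re c - x)) / 2" for x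
    using log_form_top(3)[OF top_in_slit_strip] by (simp del: Re_Ln)
  show "continuous_on {a..a'} (\<lambda>x. H (Complex x pi))"
    by (intro H_horizontal_continuous top_in_slit_strip)
  show "((\<lambda>x. H (Complex x pi)) has_vector_derivative log_form lam (Complex x pi)) (at x)" for x
    by (intro H_horizontal_vector_derivative top_in_slit_strip)
qed (use assms Re_c in \<open>auto intro!: continuous_intros derivative_eq_intros\<close>)

text \<open>Integrate the bound of \<open>log_form_vertical\<close>; the worst case is
  \<open>b\<close> near -pi with \<open>Im c = 0\<close>, and it gives 8.8 * sqrt (5 pi) <
  36.\<close>

lemma H_transversal_le:
  assumes "- pi < b" "b \<le> pi"
  shows "cmod (H (transversal c pi) - H (transversal c b)) \<le> 36"
proof -
  let ?g = "\<lambda>t. 11/10 * (sqrt 5 * (2 * sqrt t + 2 * sqrt (t - Im c)))"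
  let ?g' = "\<lambda>t. 11/10 * (sqrt 5 * (1 / sqrt \<bar>t\<bar> + 1 / sqrt \<bar>t - Im c\<bar>))"
  let ?d = "Complex (Im c / 16) 1"
  define v where "v = c / 2 - of_real (Im c / 2) * ?d"
  have p: "transversal c t = v + of_real t * ?d" for t
    by (simp add: transversal_def v_def algebra_simps)
  have in_S: "v + of_real t * ?d \<in> slit_strip c" if "b \<le> t" "t \<le> pi" for t
    unfolding p[symmetric] using that assms by (intro transversal_in_slit_strip Re_c c_nonzero) auto
  \<comment> \<open>The slope is at most pi/32, as |Im c| < pi/2.\<close>
  have d: "cmod ?d \<le> 11/10"
    using cmod_le[of ?d] Im_c pi_approx by simp
  \<comment> \<open>The real \<open>sqrt\<close> is an odd function, so
    \<open>2 * sqrt (t - s)\<close> is a continuous primitive of the inverse root on both sides of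
    the singularity \<open>s\<close>.\<close>
  have Dsqrt: "((\<lambda>t. 2 * sqrt (t - s)) has_real_derivative 1 / sqrt \<bar>t - s\<bar>) (at t)" if "t \<noteq> s" for t s :: real
  proof -
    have "sqrt (t - s) = - sqrt (s - t)" using real_sqrt_minus[of "s - t"] by simp
    then have "DERIV sqrt (t - s) :> 1 / sqrt \<bar>t - s\<bar> / 2"
      using that by (intro DERIV_real_sqrt_generic) (auto simp: field_simps abs_if)
    then have "((\<lambda>t. sqrt (t - s)) has_real_derivative 1 / sqrt \<bar>t - s\<bar> / 2 * 1) (at t)"
      by (rule DERIV_chain2) (auto intro!: derivative_eq_intros)
    from DERIV_cmult[OF this, of 2] show ?thesis by simp
  qed
  have "cmod (H (transversal c pi) - H (transversal c b)) \<le> ?g pi - ?g b"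
    unfolding p
  proof (rule norm_diff_le_majorant[where S = "{0, Im c}" and F = "\<lambda>t. H (v + of_real t * ?d)" 
        and F' = "\<lambda>t. ?d * log_form lam (v + of_real t * ?d)" and g = ?g and g' = ?g'])
    show "continuous_on {b..pi} (\<lambda>t. H (v + of_real t * ?d))"
      using in_S by (intro continuous_at_imp_continuous_on ballI has_vector_derivative_continuous[OF H_line_vector_derivative]) auto
    show "continuous_on {b..pi} ?g" by (intro continuous_intros)
  next
    fix t assume t: "t \<in> {b<..<pi} - {0, Im c}"
    then show "((\<lambda>t. H (v + of_real t * ?d)) has_vector_derivative ?d * log_form lam (v + of_real t * ?d)) (at t)"
      using in_S by (intro H_line_vector_derivative) auto
    show "(?g has_real_derivative ?g' t) (at t)"
      using Dsqrt[of t 0] Dsqrt[of t "Im c"] t by (intro DERIV_cmult DERIV_add) auto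
    have "Im (v + of_real t * ?d) = t" unfolding p[symmetric] by simp
    then have "cmod (log_form lam (v + of_real t * ?d)) \<le> sqrt 5 * (1 / sqrt \<bar>t\<bar> + 1 / sqrt \<bar>t - Im c\<bar>)"
      using log_form_vertical[of "v + of_real t * ?d"] t assms by (auto simp: abs_le_iff)
    then show "cmod (?d * log_form lam (v + of_real t * ?d)) \<le> ?g' t"
      unfolding norm_mult using d by (intro mult_mono) auto
  qed (use assms in auto)
  also have "\<dots> = 22/10 * (sqrt 5 * ((sqrt pi - sqrt b) + (sqrt (pi - Im c) - sqrt (b - Im c))))"
    by (simp add: algebra_simps)
  also have "\<dots> \<le> 22/10 * (sqrt 5 * ((sqrt pi + sqrt pi) + (sqrt (pi - Im c) + sqrt (pi + Im c))))"
  proof -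
    have "- sqrt b = sqrt (- b)" "- sqrt (b - Im c) = sqrt (Im c - b)"
      by (simp_all flip: real_sqrt_minus)
    moreover have "sqrt (- b) \<le> sqrt pi" "sqrt (Im c - b) \<le> sqrt (pi + Im c)" using assms by auto
    ultimately show ?thesis by (intro mult_left_mono) (linarith | simp)+
  qed
  also have "\<dots> \<le> 22/10 * (sqrt 5 * (4 * sqrt pi))"
  proof -
    have "(sqrt (pi - Im c) + sqrt (pi + Im c))\<^sup>2 \<le> (2 * sqrt pi)\<^sup>2"
    proof -
      have "(sqrt (pi - Im c) + sqrt (pi + Im c))\<^sup>2 + (sqrt (pi - Im c) - sqrt (pi + Im c))\<^sup>2 = 4 * pi"
        using Im_c by (simp add: power2_sum power2_diff)
      moreover have "0 \<le> (sqrt (pi - Im c) - sqrt (pi + Im c))\<^sup>2" by simp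
      ultimately have "(sqrt (pi - Im c) + sqrt (pi + Im c))\<^sup>2 \<le> 4 * pi" by linarith
      then show ?thesis by (simp add: power_mult_distrib)
    qed
    then have "sqrt (pi - Im c) + sqrt (pi + Im c) \<le> 2 * sqrt pi" by (rule power2_le_imp_le) simp
    then show ?thesis by (intro mult_left_mono) auto
  qed
  also have "\<dots> = 88/10 * sqrt (5 * pi)" by (simp add: real_sqrt_mult)
  also have "\<dots> \<le> 88/10 * 4"
    using pi_approx by (intro mult_left_mono real_le_lsqrt) auto
  finally show ?thesis by simp
qed

end

section \<open>The two periods\<close>

text \<open>The integrand of \<omega>1 in the degenerate case lam = 0; a multiple of it dominates
  the general integrand, and it is itself a lower bound for the modulus.\<close>

lemma integral_arctan_1:
  "set_integrable lborel {1<..} (\<lambda>x::real. 1 / (x * sqrt (x - 1)))"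
  "(LBINT x:{1<..}. 1 / (x * sqrt (x - 1))) = pi"
proof -
  let ?F = "\<lambda>x::real. 2 * arctan (sqrt (x - 1))" and ?f = "\<lambda>x::real. 1 / (x * sqrt (x - 1))"
  have D: "(?F has_real_derivative ?f x) (at x)" if "1 < x" for x
    using that by (auto intro!: derivative_eq_intros simp: field_simps)
  have C: "isCont ?f x" if "1 < x" for x
    using that by (intro continuous_intros) auto
  have L0: "(?F \<longlongrightarrow> 0) (at_right 1)"
  proof -
    have "(?F \<longlongrightarrow> 2 * arctan (sqrt (1 - 1))) (at_right 1)" by (intro tendsto_intros)
    then show ?thesis by simp
  qed
  have L1: "(?F \<longlongrightarrow> pi) at_top"
  proof -
    have "filterlim (\<lambda>x::real. sqrt (x - 1)) at_top at_top"
      by (rule filterlim_compose[OF sqrt_at_top]) real_asymp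
    from tendsto_mult[OF tendsto_const[of 2] filterlim_compose[OF tendsto_arctan_at_top this]]
    show ?thesis by simp
  qed
  have eq: "einterval 1 \<infinity> = {1<..}" by (auto simp: einterval_def one_ereal_def)
  note FTC = interval_integral_FTC_nonneg[of 1 \<infinity> ?F ?f 0 pi]
  have prem: "(1::ereal) < \<infinity>" "((?F \<circ> real_of_ereal) \<longlongrightarrow> 0) (at_right 1)"
      "((?F \<circ> real_of_ereal) \<longlongrightarrow> pi) (at_left \<infinity>)"
    using L0 L1 by (simp_all add: ereal_tendsto_simps one_ereal_def)
  show "set_integrable lborel {1<..} ?f"
    using FTC(1) prem D C by (simp add: eq one_ereal_def)
  show "(LBINT x:{1<..}. ?f x) = pi"
    using FTC(2) prem D C by (simp add: interval_lebesgue_integral_le_eq eq one_ereal_def)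
qed

text \<open>The integrand of \<open>\<omega>\<^sub>2 / \<i>\<close> in the degenerate case lam = 1,
  after the substitution X = -x.\<close>

lemma integral_arctan_0:
  "set_integrable lborel {0<..} (\<lambda>x::real. 1 / (sqrt x * (1 + x)))"
  "(LBINT x:{0<..}. 1 / (sqrt x * (1 + x))) = pi"
proof -
  let ?F = "\<lambda>x::real. 2 * arctan (sqrt x)" and ?f = "\<lambda>x::real. 1 / (sqrt x * (1 + x))"
  have D: "(?F has_real_derivative ?f x) (at x)" if "0 < x" for x
  proof -
    have "(?F has_real_derivative 2 * (inverse (1 + (sqrt x)\<^sup>2) * (inverse (sqrt x) / 2))) (at x)"
      by (intro DERIV_cmult DERIV_chain2[OF DERIV_arctan] DERIV_real_sqrt that)
    moreover have "2 * (inverse (1 + (sqrt x)\<^sup>2) * (inverse (sqrt x) / 2)) = ?f x"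
      using that by (simp add: inverse_eq_divide mult.commute)
    ultimately show ?thesis by (simp only:)
  qed
  have C: "isCont ?f x" if "0 < x" for x
    using that by (intro continuous_intros) auto
  have L0: "(?F \<longlongrightarrow> 0) (at_right 0)"
  proof -
    have "(?F \<longlongrightarrow> 2 * arctan (sqrt 0)) (at_right 0)" by (intro tendsto_intros)
    then show ?thesis by simp
  qed
  have L1: "(?F \<longlongrightarrow> pi) at_top"
    using tendsto_mult[OF tendsto_const[of 2] filterlim_compose[OF tendsto_arctan_at_top sqrt_at_top]]
    by simp
  have eq: "einterval 0 \<infinity> = {0<..}" by (auto simp: einterval_def zero_ereal_def)
  note FTC = interval_integral_FTC_nonneg[of 0 \<infinity> ?F ?f 0 pi]
  have prem: "(0::ereal) < \<infinity>" "((?F \<circ> real_of_ereal) \<longlongrightarrow> 0) (at_right 0)"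
      "((?F \<circ> real_of_ereal) \<longlongrightarrow> pi) (at_left \<infinity>)"
    using L0 L1 by (simp_all add: ereal_tendsto_simps zero_ereal_def)
  show "set_integrable lborel {0<..} ?f"
    using FTC(1) prem D C by (simp add: eq zero_ereal_def)
  show "(LBINT x:{0<..}. ?f x) = pi"
    using FTC(2) prem D C by (simp add: interval_lebesgue_integral_le_eq eq zero_ereal_def)
qed

lemma csqrt_of_real_mult:
  assumes "0 \<le> a"
  shows "csqrt (of_real a * z) = of_real (sqrt a) * csqrt z"
proof (cases "a = 0")
  case False
  then have "sqrt a > 0" using assms by simp
  then show ?thesis
    using csqrt_principal[of z] assms
    by (intro csqrt_unique) (auto simp: power_mult_distrib simp del: csqrt.sel simp flip: of_real_power)
qed simp

text \<open>The right-hand side of the pointwise hypothesis is real-linear in \<open>f\<close>, so a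
  cone condition passes to the integral. It is applied once in each variable, with the other factor
  as \<open>d\<close>.\<close>

lemma cone_integral:
  fixes f :: "'a \<Rightarrow> complex"
  assumes f: "set_integrable M A f" and le: "\<And>x. x \<in> A \<Longrightarrow> k * cmod (f x) \<le> Re (f x * d)"
  shows "k * (LINT x:A|M. cmod (f x)) \<le> Re ((LINT x:A|M. f x) * d)"
proof -
  let ?g = "\<lambda>x. indicat_real A x *\<^sub>R f x"
  have g: "integrable M ?g" using f by (simp add: set_integrable_def)
  have T: "bounded_linear (\<lambda>z. Re (z * d))"
    by (rule bounded_linear_compose[OF bounded_linear_Re bounded_linear_mult_left])
  have "k * (LINT x:A|M. cmod (f x)) = (LINT x|M. k * cmod (?g x))"
    unfolding set_lebesgue_integral_def by (subst integral_mult_right_zero[symmetric]) (simp add: mult.left_commute)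
  also have "\<dots> \<le> (LINT x|M. Re (?g x * d))"
  proof (rule integral_mono)
    show "integrable M (\<lambda>x. k * cmod (?g x))" using g by (intro integrable_mult_right integrable_norm)
    show "integrable M (\<lambda>x. Re (?g x * d))" by (rule integrable_bounded_linear[OF T g])
    show "k * cmod (?g x) \<le> Re (?g x * d)" for x
      using le[of x] by (cases "x \<in> A") auto
  qed
  also have "\<dots> = Re ((LINT x|M. ?g x) * d)" by (rule integral_bounded_linear[OF T g])
  finally show ?thesis by (simp add: set_lebesgue_integral_def)
qed

context legendre_param
begin

definition right_integrand :: "real \<Rightarrow> complex" where
  "right_integrand x = 1 / (of_real (sqrt (x * (x - 1))) * csqrt (of_real x - lam))"

text \<open>Comes from X = -t with the positive factor t (1 + t) taken out of the root. What remains
  under the root has positive real part, so the principal branch is continuous.\<close>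

definition left_integrand :: "real \<Rightarrow> complex" where
  "left_integrand t = 1 / (of_real (sqrt (t * (1 + t))) * csqrt (of_real t + lam))"

lemma cubic_right:
  assumes "1 < x"
  shows "1 / csqrt (legendre_cubic lam (of_real x)) = right_integrand x"
proof -
  have "legendre_cubic lam (of_real x) = of_real (x * (x - 1)) * (of_real x - lam)"
    by (simp add: legendre_cubic_def)
  then show ?thesis unfolding right_integrand_def using assms by (subst csqrt_of_real_mult[symmetric]) auto
qed

lemma cubic_left:
  assumes "0 < t"
  shows "1 / csqrt_pos_cut (legendre_cubic lam (of_real (- t))) = - \<i> * left_integrand t"
proof -
  have "- legendre_cubic lam (of_real (- t)) = of_real (t * (1 + t)) * (of_real t + lam)"
    by (simp add: legendre_cubic_def algebra_simps)
  then have "csqrt_pos_cut (legendre_cubic lam (of_real (- t))) = 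
      \<i> * (of_real (sqrt (t * (1 + t))) * csqrt (of_real t + lam))"
    unfolding csqrt_pos_cut_def using assms by (subst csqrt_of_real_mult[symmetric]) auto
  then show ?thesis by (simp add: left_integrand_def divide_simps)
qed

lemma Re_right: "1 < x \<Longrightarrow> x / 2 \<le> Re (of_real x - lam)"
  and Re_left: "0 < t \<Longrightarrow> Re lam * (1 + t) \<le> Re (of_real t + lam)"
proof -
  show "1 < x \<Longrightarrow> x / 2 \<le> Re (of_real x - lam)" using legendre_regionD(5)[OF lam] by simp
  have "Re lam * t \<le> 1 * t" if "0 < t" using that legendre_regionD(5)[OF lam] by (intro mult_right_mono) auto
  then show "0 < t \<Longrightarrow> Re lam * (1 + t) \<le> Re (of_real t + lam)" by (simp add: algebra_simps)
qed

text \<open>For the upper bound, the disc of radius 1 about 1 lies in the disc of radius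
  \<open>x\<close> about \<open>x\<close>, both touching the imaginary axis at 0.\<close>

lemma cmod_right:
  assumes "1 < x"
  shows "x / 2 \<le> cmod (of_real x - lam)" "cmod (of_real x - lam) \<le> x"
proof -
  show "x / 2 \<le> cmod (of_real x - lam)" using Re_right[OF assms] complex_Re_le_cmod order_trans by blast
  have "(cmod (of_real x - lam))\<^sup>2 = x\<^sup>2 - x * (2 * Re lam) + (cmod lam)\<^sup>2"
    unfolding cmod_power2 by (simp add: power2_eq_square algebra_simps)
  moreover have "1 * (2 * Re lam) \<le> x * (2 * Re lam)"
    using assms legendre_regionD(4)[OF lam] by (intro mult_right_mono) auto
  ultimately have "(cmod (of_real x - lam))\<^sup>2 \<le> x\<^sup>2" using legendre_regionD(6)[OF lam] by linarith
  then show "cmod (of_real x - lam) \<le> x" by (rule power2_le_imp_le) (use assms in auto)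
qed

lemma cmod_left:
  assumes "0 < t"
  shows "Re lam * (1 + t) \<le> cmod (of_real t + lam)" "cmod (of_real t + lam) \<le> 1 + t"
proof -
  show "Re lam * (1 + t) \<le> cmod (of_real t + lam)"
    using Re_left[OF assms] complex_Re_le_cmod order_trans by blast
  show "cmod (of_real t + lam) \<le> 1 + t"
    using norm_triangle_ineq[of "of_real t" lam] assms legendre_regionD(2)[OF lam] by simp
qed

lemma cmod_right_integrand:
  assumes "1 < x"
  shows "1 / (x * sqrt (x - 1)) \<le> cmod (right_integrand x)" "cmod (right_integrand x) \<le> sqrt 2 * (1 / (x * sqrt (x - 1)))"
proof -
  have eq: "cmod (right_integrand x) = 1 / (sqrt (x - 1) * sqrt (x * cmod (of_real x - lam)))"
    using assms by (simp add: right_integrand_def norm_divide norm_mult real_sqrt_mult)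
  have "sqrt (x * cmod (of_real x - lam)) \<le> sqrt (x * x)"
    using cmod_right[OF assms] assms by (intro real_sqrt_le_mono mult_left_mono) auto
  then have 1: "sqrt (x * cmod (of_real x - lam)) \<le> x" using assms by simp
  have "sqrt (x * (x / 2)) \<le> sqrt (x * cmod (of_real x - lam))"
    using cmod_right[OF assms] assms by (intro real_sqrt_le_mono mult_left_mono) auto
  moreover have "sqrt (x * (x / 2)) = x / sqrt 2" using assms by (simp add: real_sqrt_divide)
  ultimately have 2: "x / sqrt 2 \<le> sqrt (x * cmod (of_real x - lam))" by argo
  have p: "0 < sqrt (x - 1)" "0 < x / sqrt 2" using assms by auto
  have 3: "0 < sqrt (x * cmod (of_real x - lam))" using 2 p by linarith
  have "1 / (sqrt (x - 1) * x) \<le> cmod (right_integrand x)"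
    unfolding eq by (intro frac_le mult_left_mono mult_pos_pos) (use 1 3 p in auto)
  then show "1 / (x * sqrt (x - 1)) \<le> cmod (right_integrand x)" by (simp only: mult.commute)
  have "cmod (right_integrand x) \<le> 1 / (sqrt (x - 1) * (x / sqrt 2))"
    unfolding eq by (intro frac_le mult_left_mono mult_pos_pos) (use 2 p in auto)
  then show "cmod (right_integrand x) \<le> sqrt 2 * (1 / (x * sqrt (x - 1)))" by (simp add: mult.commute)
qed

text \<open>The upper bound degenerates as \<open>Re lam\<close> tends to 0 and serves integrability
  only; the estimates uniform in \<open>lam\<close> use the lower bound.\<close>

lemma cmod_left_integrand:
  assumes "0 < t"
  shows "1 / (sqrt t * (1 + t)) \<le> cmod (left_integrand t)"
    "cmod (left_integrand t) \<le> 1 / sqrt (Re lam) * (1 / (sqrt t * (1 + t)))"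
proof -
  have r: "0 < Re lam" using legendre_regionD(4)[OF lam] .
  have eq: "cmod (left_integrand t) = 1 / (sqrt t * sqrt ((1 + t) * cmod (of_real t + lam)))"
    using assms by (simp add: left_integrand_def norm_divide norm_mult real_sqrt_mult)
  have "sqrt ((1 + t) * cmod (of_real t + lam)) \<le> sqrt ((1 + t) * (1 + t))"
    using cmod_left[OF assms] assms by (intro real_sqrt_le_mono mult_left_mono) auto
  then have 1: "sqrt ((1 + t) * cmod (of_real t + lam)) \<le> 1 + t" using assms by simp
  have "sqrt ((1 + t) * (Re lam * (1 + t))) \<le> sqrt ((1 + t) * cmod (of_real t + lam))"
    using cmod_left[OF assms] assms by (intro real_sqrt_le_mono mult_left_mono) auto
  moreover have "sqrt ((1 + t) * (Re lam * (1 + t))) = sqrt (Re lam) * (1 + t)"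
    using assms by (simp add: real_sqrt_mult mult.left_commute)
  ultimately have 2: "sqrt (Re lam) * (1 + t) \<le> sqrt ((1 + t) * cmod (of_real t + lam))" by (simp only:)
  have p: "0 < sqrt t" "0 < sqrt (Re lam) * (1 + t)" using assms r by auto
  have 3: "0 < sqrt ((1 + t) * cmod (of_real t + lam))" using 2 p by linarith
  show "1 / (sqrt t * (1 + t)) \<le> cmod (left_integrand t)"
    unfolding eq by (intro frac_le mult_left_mono mult_pos_pos) (use 1 3 p in auto)
  have "cmod (left_integrand t) \<le> 1 / (sqrt t * (sqrt (Re lam) * (1 + t)))"
    unfolding eq by (intro frac_le mult_left_mono mult_pos_pos) (use 2 p r in auto)
  then show "cmod (left_integrand t) \<le> 1 / sqrt (Re lam) * (1 / (sqrt t * (1 + t)))" by (simp add: mult.left_commute)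
qed

lemma continuous_right_integrand: "continuous_on {1<..} right_integrand"
proof -
  have "of_real x - lam \<notin> \<real>\<^sub>\<le>\<^sub>0" if "1 < x" for x :: real
    using Re_right[OF that] that by (auto simp: complex_nonpos_Reals_iff)
  moreover from this have "of_real x - lam \<noteq> 0" if "1 < x" for x :: real
    using that by force
  moreover from calculation have "continuous_on {1<..} (\<lambda>x::real. csqrt (of_real x - lam))"
    by (intro continuous_on_compose2[OF continuous_on_csqrt] continuous_intros) auto
  ultimately show ?thesis unfolding right_integrand_def by (intro continuous_intros) auto
qed

lemma continuous_left_integrand: "continuous_on {0<..} left_integrand"
proof -
  have "of_real t + lam \<notin> \<real>\<^sub>\<le>\<^sub>0" if "0 < t" for t :: real
    using legendre_regionD(4)[OF lam] that by (auto simp: complex_nonpos_Reals_iff)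
  moreover from this have "of_real t + lam \<noteq> 0" if "0 < t" for t :: real
    using that by force
  moreover from calculation have "continuous_on {0<..} (\<lambda>t::real. csqrt (of_real t + lam))"
    by (intro continuous_on_compose2[OF continuous_on_csqrt] continuous_intros) auto
  ultimately show ?thesis unfolding left_integrand_def by (intro continuous_intros) auto
qed

lemma set_integrable_right_integrand: "set_integrable lborel {1<..} right_integrand"
proof (rule set_integrable_bound[where f = "\<lambda>x. sqrt 2 * (1 / (x * sqrt (x - 1)))"])
  show "set_integrable lborel {1<..} (\<lambda>x::real. sqrt 2 * (1 / (x * sqrt (x - 1))))"
    by (intro set_integrable_mult_right integral_arctan_1)
  show "set_borel_measurable lborel {1<..} right_integrand"
    using borel_measurable_continuous_on_indicator[OF _ continuous_right_integrand] by (simp add: set_borel_measurable_def)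
  show "AE x in lborel. x \<in> {1<..} \<longrightarrow> norm (right_integrand x) \<le> norm (sqrt 2 * (1 / (x * sqrt (x - 1))))"
    by (intro AE_I2 impI) (simp only: real_norm_def greaterThan_iff, rule order_trans[OF cmod_right_integrand(2) abs_ge_self])
qed

lemma set_integrable_left_integrand: "set_integrable lborel {0<..} left_integrand"
proof (rule set_integrable_bound[where f = "\<lambda>t. 1 / sqrt (Re lam) * (1 / (sqrt t * (1 + t)))"])
  show "set_integrable lborel {0<..} (\<lambda>t::real. 1 / sqrt (Re lam) * (1 / (sqrt t * (1 + t))))"
    by (intro set_integrable_mult_right integral_arctan_0)
  show "set_borel_measurable lborel {0<..} left_integrand"
    using borel_measurable_continuous_on_indicator[OF _ continuous_left_integrand] by (simp add: set_borel_measurable_def)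
  show "AE t in lborel. t \<in> {0<..} \<longrightarrow> norm (left_integrand t) \<le> norm (1 / sqrt (Re lam) * (1 / (sqrt t * (1 + t))))"
    by (intro AE_I2 impI) (simp only: real_norm_def greaterThan_iff, rule order_trans[OF cmod_left_integrand(2) abs_ge_self])
qed

text \<open>The masses bound the periods from above, and by the cone condition their product bounds
  \<open>betti_denom\<close> from below. So the quotient of a period by the denominator is
  controlled although \<omega>2 itself is unbounded in \<open>lam\<close>.\<close>

definition "right_mass = (LBINT x:{1<..}. cmod (right_integrand x))"
definition "left_mass = (LBINT t:{0<..}. cmod (left_integrand t))"
definition "left_period = (LBINT t=0..\<infinity>. left_integrand t)"

lemma left_period_eq: "left_period = (LBINT t:{0<..}. left_integrand t)"
proof -
  have "einterval 0 \<infinity> = {0<..}" by (auto simp: einterval_def zero_ereal_def)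
  then show ?thesis by (simp add: left_period_def interval_lebesgue_integral_le_eq)
qed

lemma omega1_eq: "omega1 lam = (LBINT x:{1<..}. right_integrand x)"
proof -
  have eq: "einterval 1 \<infinity> = {1<..}" by (auto simp: einterval_def one_ereal_def)
  have "omega1 lam = (LBINT x:{1<..}. 1 / csqrt (legendre_cubic lam (of_real x)))"
    by (simp add: omega1_def interval_lebesgue_integral_le_eq eq)
  also have "\<dots> = (LBINT x:{1<..}. right_integrand x)"
    by (intro set_lebesgue_integral_cong) (auto simp: cubic_right)
  finally show ?thesis .
qed

lemma omega2_eq: "omega2 lam = \<i> * left_period"
proof -
  let ?g = "\<lambda>X::real. 1 / csqrt_pos_cut (legendre_cubic lam (of_real X))"
  have eq: "einterval 0 \<infinity> = {0<..}" by (auto simp: einterval_def zero_ereal_def)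
  have "omega2 lam = (LBINT x=\<infinity>..0. ?g (- x))"
    unfolding omega2_def by (subst interval_integral_reflect) simp
  also have "\<dots> = - (LBINT x=0..\<infinity>. ?g (- x))"
    by (rule interval_integral_endpoints_reverse)
  also have "(LBINT x=0..\<infinity>. ?g (- x)) = (LBINT x=0..\<infinity>. - \<i> * left_integrand x)"
    by (intro interval_integral_cong) (auto simp: eq cubic_left simp del: of_real_minus)
  also have "\<dots> = - \<i> * left_period" unfolding left_period_def by (rule interval_lebesgue_integral_mult_right)
  finally show ?thesis by simp
qed

lemma elliptic_log_real_eq:
  assumes "0 < \<tau>"
  shows "elliptic_log_real lam (- \<tau>) = \<i> / 2 * (LBINT t=ereal \<tau>..\<infinity>. left_integrand t)"
proof -
  let ?g = "\<lambda>X::real. 1 / (2 * csqrt_pos_cut (legendre_cubic lam (of_real X)))"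
  have g: "?g (- x) = - \<i> / 2 * left_integrand x" if "0 < x" for x
    using cubic_left[OF that] by (simp add: divide_simps del: of_real_minus)
  have "elliptic_log_real lam (- \<tau>) = (LBINT x=\<infinity>..\<tau>. ?g (- x))"
    unfolding elliptic_log_real_def by (subst interval_integral_reflect) simp
  also have "\<dots> = - (LBINT x=\<tau>..\<infinity>. ?g (- x))"
    by (rule interval_integral_endpoints_reverse)
  also have "(LBINT x=\<tau>..\<infinity>. ?g (- x)) = (LBINT x=\<tau>..\<infinity>. - \<i> / 2 * left_integrand x)"
    by (intro interval_integral_cong g) (use assms in \<open>auto simp: einterval_def\<close>)
  also have "\<dots> = - \<i> / 2 * (LBINT t=\<tau>..\<infinity>. left_integrand t)" by (rule interval_lebesgue_integral_mult_right)
  finally show ?thesis by simp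
qed

text \<open>In the triangle with vertices \<open>-t\<close>, \<open>x\<close>, \<open>lam\<close> the side opposite to \<open>lam\<close> is the longest one,
  so the angle at \<open>lam\<close> is at least \<open>\<pi>/3\<close>. Halving the complementary angle by the square
  roots leaves an angle of at most \<open>\<pi>/3\<close> between \<open>right_integrand x\<close> and \<open>left_integrand t\<close>.\<close>

lemma right_integrand_left_integrand_cone:
  assumes x: "1 < x" and t: "0 < t"
  shows "1/2 * cmod (left_integrand t) * cmod (right_integrand x) \<le> Re (right_integrand x * cnj (left_integrand t))"
proof -
  define u where "u = of_real x - lam"
  define v where "v = of_real t + lam"
  define d where "d = csqrt u * cnj (csqrt v)"
  define s where "s = sqrt (x * (x - 1)) * sqrt (t * (1 + t))"
  have s: "s > 0" using x t by (simp add: s_def)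
  have Re_u: "0 < Re u" using Re_right[OF x] x by (simp add: u_def)
  have Re_v: "0 < Re v" using legendre_regionD(4)[OF lam] t by (simp add: v_def)
  have cone: "\<bar>Im (csqrt w)\<bar> \<le> Re (csqrt w)" if "0 < Re w" for w
  proof -
    have "0 < Re ((csqrt w)\<^sup>2)" using that by simp
    then have "(Im (csqrt w))\<^sup>2 \<le> (Re (csqrt w))\<^sup>2"
      unfolding power2_eq_square[of "csqrt w"] by (simp add: power2_eq_square del: csqrt.sel)
    then show ?thesis using abs_le_square_iff[of "Im (csqrt w)" "Re (csqrt w)"] Re_csqrt[of w]
      by (simp del: csqrt.sel)
  qed
  have "\<bar>Im (csqrt u) * Im (csqrt v)\<bar> \<le> Re (csqrt u) * Re (csqrt v)"
    unfolding abs_mult using cone[OF Re_u] cone[OF Re_v] Re_csqrt by (intro mult_mono) (auto simp del: csqrt.sel)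
  then have Re_d: "0 \<le> Re d" by (simp add: d_def del: csqrt.sel)
  have d2: "d\<^sup>2 = u * cnj v"
    by (simp add: d_def power_mult_distrib flip: complex_cnj_power)
  have law: "2 * Re (u * cnj v) = (x + t)\<^sup>2 - (cmod u)\<^sup>2 - (cmod v)\<^sup>2"
    unfolding cmod_power2 by (simp add: u_def v_def power2_eq_square algebra_simps)
  have uv: "0 \<le> cmod u" "cmod u \<le> x + t" "0 \<le> cmod v" "cmod v \<le> x + t"
    using cmod_right[OF x] cmod_left[OF t] x t by (auto simp: u_def v_def)
  have "(cmod u)\<^sup>2 + (cmod v)\<^sup>2 - cmod u * cmod v \<le> (x + t)\<^sup>2"
  proof (cases "cmod u \<le> cmod v")
    case True
    then have "cmod u * cmod u \<le> cmod u * cmod v" using uv by (intro mult_left_mono)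
    moreover have "(cmod v)\<^sup>2 \<le> (x + t)\<^sup>2" using uv by (intro power_mono) auto
    ultimately show ?thesis by (simp add: power2_eq_square)
  next
    case False
    then have "cmod v * cmod v \<le> cmod u * cmod v" using uv by (intro mult_right_mono) auto
    moreover have "(cmod u)\<^sup>2 \<le> (x + t)\<^sup>2" using uv by (intro power_mono) auto
    ultimately show ?thesis by (simp add: power2_eq_square)
  qed
  then have "- (cmod u * cmod v) \<le> 2 * Re (d\<^sup>2)" unfolding d2 law by linarith
  moreover have "cmod u * cmod v = (cmod d)\<^sup>2" 
    unfolding norm_power[symmetric] d2 by (simp add: norm_mult)
  ultimately have "(cmod d)\<^sup>2 \<le> (2 * Re d)\<^sup>2"
    unfolding cmod_power2 by (simp add: power2_eq_square)
  then have cone_d: "cmod d \<le> 2 * Re d" by (rule power2_le_imp_le) (use Re_d in auto)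
  have eq: "right_integrand x * cnj (left_integrand t) = of_real (1 / s) * inverse d"
    by (simp add: right_integrand_def left_integrand_def d_def s_def u_def v_def divide_simps)
  have "u \<noteq> 0" "v \<noteq> 0" using Re_u Re_v by auto
  then have "d \<noteq> 0" by (simp add: d_def)
  have "Re (right_integrand x * cnj (left_integrand t)) = (1 / s) * (Re d / (cmod d)\<^sup>2)"
    unfolding eq by (simp add: cmod_power2)
  moreover have "1/2 * cmod (left_integrand t) * cmod (right_integrand x) = 1/2 * cmod (right_integrand x * cnj (left_integrand t))"
    by (simp add: norm_mult)
  moreover have "\<dots> = (1 / s) * (cmod d / 2 / (cmod d)\<^sup>2)"
    unfolding eq norm_mult norm_inverse norm_of_real using s \<open>d \<noteq> 0\<close> by (simp add: power2_eq_square field_simps)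
  moreover have "(1 / s) * (cmod d / 2 / (cmod d)\<^sup>2) \<le> (1 / s) * (Re d / (cmod d)\<^sup>2)"
    using s cone_d by (intro mult_left_mono divide_right_mono) auto
  ultimately show ?thesis by linarith
qed

lemma mass_ge_pi: "pi \<le> right_mass" "pi \<le> left_mass"
proof -
  show "pi \<le> right_mass"
    unfolding right_mass_def integral_arctan_1(2)[symmetric]
    by (intro set_integral_mono integral_arctan_1 set_integrable_norm set_integrable_right_integrand) (auto simp: cmod_right_integrand)
  show "pi \<le> left_mass"
    unfolding left_mass_def integral_arctan_0(2)[symmetric]
    by (intro set_integral_mono integral_arctan_0 set_integrable_norm set_integrable_left_integrand) (auto simp: cmod_left_integrand)
qed

lemma cmod_omega_le: "cmod (omega1 lam) \<le> right_mass" "cmod (omega2 lam) \<le> left_mass"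
  unfolding omega1_eq omega2_eq left_period_eq right_mass_def left_mass_def norm_mult
  using set_integral_norm_bound[OF set_integrable_right_integrand] set_integral_norm_bound[OF set_integrable_left_integrand]
  by auto

text \<open>Since \<omega>2 is \<i> times \<open>left_period\<close>, the denominator is -2 \<i> Re
  (\<open>left_period * cnj (omega1 lam)\<close>). Integrating the cone condition over x and then
  over t bounds this real part by 1/2, the cosine of pi/3, times both masses; the factor 2 cancels
  it.\<close>

lemma cmod_betti_denom_ge: "right_mass * left_mass \<le> cmod (betti_denom lam)"
proof -
  have 1: "1/2 * cmod (left_integrand t) * right_mass \<le> Re (omega1 lam * cnj (left_integrand t))" if "0 < t" for t
    unfolding omega1_eq right_mass_def using right_integrand_left_integrand_cone[OF _ that] 
    by (intro cone_integral[OF set_integrable_right_integrand]) auto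
  have "1/2 * right_mass * left_mass \<le> Re (left_period * cnj (omega1 lam))"
    unfolding left_period_eq left_mass_def
  proof (rule cone_integral[OF set_integrable_left_integrand])
    fix t :: real assume "t \<in> {0<..}"
    moreover have "Re (omega1 lam * cnj (left_integrand t)) = Re (left_integrand t * cnj (omega1 lam))" by simp
    ultimately show "1/2 * right_mass * cmod (left_integrand t) \<le> Re (left_integrand t * cnj (omega1 lam))"
      using 1[of t] by (simp add: mult.commute)
  qed
  moreover have "betti_denom lam = of_real (2 * Re (left_period * cnj (omega1 lam))) * (- \<i>)"
    by (simp add: betti_denom_def omega2_eq complex_eq_iff algebra_simps)
  then have "cmod (betti_denom lam) = \<bar>2 * Re (left_period * cnj (omega1 lam))\<bar>"
    by (simp only: norm_mult norm_of_real norm_minus_cancel norm_ii mult_1_right)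
  ultimately show ?thesis by simp
qed

end

section \<open>The elliptic logarithm\<close>

context legendre_primitive
begin

text \<open>This matches the sign of the branch in \<open>log_form\<close> with the root prescribed
  on the negative axis: along X = -\<tau> the primitive has derivative
  \<open>left_integrand \<tau>\<close> divided by 2 \<i>.\<close>

lemma log_form_top_eq:
  assumes "0 < \<tau>"
  shows "2 * \<i> * (inverse \<tau> *\<^sub>R log_form lam (Complex (ln \<tau>) pi)) = left_integrand \<tau>"
proof -
  have X: "exp (Complex (ln \<tau>) pi) = - of_real \<tau>"
    using assms by (simp add: exp_eq_polar)
  have "1 + lam / of_real \<tau> = of_real (1 / \<tau>) * (of_real \<tau> + lam)"
    using assms by (simp add: field_simps)
  then have P: "csqrt (1 + lam / of_real \<tau>) = of_real (sqrt (1 / \<tau>)) * csqrt (of_real \<tau> + lam)"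
    using assms by (simp only:) (rule csqrt_of_real_mult, simp)
  have Q: "csqrt (1 + of_real \<tau>) = of_real (sqrt (1 + \<tau>))"
    using csqrt_of_real[of "1 + \<tau>"] assms by simp
  have "\<tau> * (sqrt (1 / \<tau>) * sqrt (1 + \<tau>)) = sqrt (\<tau> * (1 + \<tau>))"
  proof -
    have "\<tau> * sqrt (1 / \<tau>) = sqrt \<tau>" using assms by (simp add: real_sqrt_divide real_div_sqrt)
    then show ?thesis by (simp add: real_sqrt_mult mult.assoc[symmetric])
  qed
  then have "of_real (sqrt (\<tau> * (1 + \<tau>))) = 
      (of_real \<tau> * (of_real (sqrt (1 / \<tau>)) * of_real (sqrt (1 + \<tau>))) :: complex)"
    by (simp only: of_real_mult[symmetric])
  moreover have "2 * \<i> * (inverse t * (1 / (2 * \<i> * (a * k) * b))) = 1 / ((t * (a * b)) * k)"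
    for t a b k :: complex
    by (cases "t = 0 \<or> a = 0 \<or> b = 0 \<or> k = 0") (auto simp: field_simps)
  moreover have "log_form lam (Complex (ln \<tau>) pi) =
      1 / (2 * \<i> * (of_real (sqrt (1 / \<tau>)) * csqrt (of_real \<tau> + lam)) * of_real (sqrt (1 + \<tau>)))"
    unfolding log_form_def X P[symmetric] Q[symmetric] by simp
  ultimately show ?thesis
    unfolding left_integrand_def scaleR_conv_of_real of_real_inverse by (simp only:)
qed

lemma integral_left_integrand_eq:
  assumes "0 < s" "0 < t"
  shows "(LBINT x=s..t. left_integrand x) = 2 * \<i> * (H (Complex (ln t) pi) - H (Complex (ln s) pi))"
proof -
  have sub: "{min s t..max s t} \<subseteq> {0<..}" using assms by auto
  have "(LBINT x=s..t. left_integrand x) = 2 * \<i> * H (Complex (ln t) pi) - 2 * \<i> * H (Complex (ln s) pi)"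
  proof (rule interval_integral_FTC_finite[where F = "\<lambda>x. 2 * \<i> * H (Complex (ln x) pi)"])
    show "continuous_on {min s t..max s t} left_integrand" by (rule continuous_on_subset[OF continuous_left_integrand sub])
    fix x assume "min s t \<le> x" "x \<le> max s t"
    then have x: "0 < x" using assms by auto
    have "(ln has_vector_derivative inverse x) (at x)"
      using x by (simp add: has_real_derivative_iff_has_vector_derivative[symmetric] DERIV_ln)
    from vector_diff_chain_at[OF this H_horizontal_vector_derivative[OF top_in_slit_strip]]
    have "((\<lambda>x. H (Complex (ln x) pi)) has_vector_derivative inverse x *\<^sub>R log_form lam (Complex (ln x) pi)) (at x)"
      by (simp only: o_def)
    from has_vector_derivative_mult_right[OF this, of "2 * \<i>"]
    show "((\<lambda>x. 2 * \<i> * H (Complex (ln x) pi)) has_vector_derivative left_integrand x) (at x within {min s t..max s t})"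
      unfolding log_form_top_eq[OF x] by (rule has_vector_derivative_at_within)
  qed
  then show ?thesis by (simp add: algebra_simps)
qed

lemma integral_left_integrand_le:
  assumes "0 < s" "s \<le> t"
  shows "cmod ((LBINT x=s..t. left_integrand x) - of_real (clip (Re c) (ln t) - clip (Re c) (ln s))) \<le> 6"
proof -
  let ?k = "of_real (clip (Re c) (ln t) - clip (Re c) (ln s)) :: complex"
  have "(LBINT x=s..t. left_integrand x) - ?k =
      2 * \<i> * (H (Complex (ln t) pi) - H (Complex (ln s) pi) - ?k * (1 / (2 * \<i>)))"
    unfolding integral_left_integrand_eq[OF assms(1) less_le_trans[OF assms]] by (simp add: algebra_simps)
  moreover have "cmod (H (Complex (ln t) pi) - H (Complex (ln s) pi) - ?k * (1 / (2 * \<i>))) \<le> 1 + 1 + 1"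
    using assms by (intro H_top_le) simp
  ultimately show ?thesis by (simp add: norm_mult del: of_real_diff)
qed

lemma omega2_estimate: "cmod (omega2 lam - \<i> * of_real (- Re c)) \<le> 6"
proof -
  obtain u l :: "nat \<Rightarrow> real" where ul: "einterval 0 \<infinity> = (\<Union>i. {l i .. u i})" "incseq u" "decseq l"
      "\<And>i. l i < u i" "\<And>i. 0 < ereal (l i)" "\<And>i. ereal (u i) < \<infinity>"
      "(\<lambda>i. ereal (l i)) \<longlonglongrightarrow> 0" "(\<lambda>i. ereal (u i)) \<longlonglongrightarrow> \<infinity>"
    by (rule einterval_Icc_approximation[of 0 \<infinity>]) auto
  have eq: "einterval 0 \<infinity> = {0<..}" by (auto simp: einterval_def zero_ereal_def)
  have "(\<lambda>i. LBINT t=l i..u i. left_integrand t) \<longlonglongrightarrow> left_period"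
    unfolding left_period_def
    by (rule interval_integral_Icc_approx_integrable[OF _ ul]) (auto simp: eq set_integrable_left_integrand)
  then have lim: "(\<lambda>i. (LBINT t=l i..u i. left_integrand t) - of_real (- Re c)) \<longlonglongrightarrow> left_period - of_real (- Re c)"
    by (intro tendsto_intros)
  have "cmod (left_period - of_real (- Re c)) \<le> 6"
  proof (rule Lim_norm_ubound[OF _ lim])
    \<comment> \<open>Once the interval contains both |lam| and 1, the \<open>clip\<close> values
      are exactly \<open>Re c\<close> and 0, so the main term no longer depends on
      \<open>i\<close>.\<close>
    have "eventually (\<lambda>i. ereal (l i) < ereal (exp (Re c))) sequentially"
      by (rule order_tendstoD(2)[OF ul(7)]) simp
    moreover have "eventually (\<lambda>i. ereal 1 < ereal (u i)) sequentially"
      by (rule order_tendstoD(1)[OF ul(8)]) simp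
    ultimately show "\<forall>\<^sub>F i in sequentially. cmod ((LBINT t=l i..u i. left_integrand t) - of_real (- Re c)) \<le> 6"
    proof eventually_elim
      case (elim i)
      have pos: "0 < l i" using ul(5)[of i] by simp
      have "ln (l i) \<le> ln (exp (Re c))" using elim(1) pos by (subst ln_le_cancel_iff) auto
      then have "ln (l i) \<le> Re c" by (simp only: ln_exp)
      then have "clip (Re c) (ln (l i)) = Re c" using Re_c by (simp add: clip_def del: Re_Ln)
      moreover have "clip (Re c) (ln (u i)) = 0" using elim(2) Re_c by (simp add: clip_def del: Re_Ln)
      ultimately show ?case using integral_left_integrand_le[OF pos less_imp_le[OF ul(4)]] by simp
    qed
  qed simp
  moreover have "omega2 lam - \<i> * of_real (- Re c) = \<i> * (left_period - of_real (- Re c))"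
    unfolding omega2_eq by (simp only: right_diff_distrib)
  ultimately show ?thesis by (simp only: norm_mult norm_ii mult_1)
qed

lemma elliptic_log_real_estimate:
  assumes "0 < \<tau>"
  shows "cmod (elliptic_log_real lam (- \<tau>) + \<i> / 2 * of_real (clip (Re c) (ln \<tau>))) \<le> 3"
proof -
  obtain u l :: "nat \<Rightarrow> real" where ul: "einterval \<tau> \<infinity> = (\<Union>i. {l i .. u i})" "incseq u" "decseq l"
      "\<And>i. l i < u i" "\<And>i. ereal \<tau> < ereal (l i)" "\<And>i. ereal (u i) < \<infinity>"
      "(\<lambda>i. ereal (l i)) \<longlonglongrightarrow> \<tau>" "(\<lambda>i. ereal (u i)) \<longlonglongrightarrow> \<infinity>"
    by (rule einterval_Icc_approximation[of \<tau> \<infinity>]) auto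
  let ?I = "LBINT t=\<tau>..\<infinity>. left_integrand t"
  have int: "set_integrable lborel (einterval \<tau> \<infinity>) left_integrand"
    by (rule set_integrable_subset[OF set_integrable_left_integrand]) (use assms in auto)
  have "(\<lambda>i. LBINT t=l i..u i. left_integrand t) \<longlonglongrightarrow> ?I"
    by (rule interval_integral_Icc_approx_integrable[OF _ ul int]) simp
  moreover have "(\<lambda>i. ln (l i)) \<longlonglongrightarrow> ln \<tau>" using ul(7) assms by (intro tendsto_ln) auto
  then have "(\<lambda>i. clip (Re c) (ln (l i))) \<longlonglongrightarrow> clip (Re c) (ln \<tau>)"
    unfolding clip_def by (intro tendsto_max tendsto_min tendsto_const)
  ultimately have lim: "(\<lambda>i. (LBINT t=l i..u i. left_integrand t) - of_real (0 - clip (Re c) (ln (l i))))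
      \<longlonglongrightarrow> ?I - of_real (0 - clip (Re c) (ln \<tau>))"
    by (intro tendsto_diff tendsto_of_real tendsto_const)
  have "cmod (?I - of_real (0 - clip (Re c) (ln \<tau>))) \<le> 6"
  proof (rule Lim_norm_ubound[OF _ lim])
    have "eventually (\<lambda>i. ereal 1 < ereal (u i)) sequentially"
      by (rule order_tendstoD(1)[OF ul(8)]) simp
    then show "\<forall>\<^sub>F i in sequentially. cmod ((LBINT t=l i..u i. left_integrand t) - of_real (0 - clip (Re c) (ln (l i)))) \<le> 6"
    proof eventually_elim
      case (elim i)
      have pos: "0 < l i" using ul(5)[of i] assms by simp
      have "clip (Re c) (ln (u i)) = 0" using elim Re_c by (simp add: clip_def del: Re_Ln)
      then show ?case using integral_left_integrand_le[OF pos less_imp_le[OF ul(4)]] by simp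
    qed
  qed simp
  moreover have "elliptic_log_real lam (- \<tau>) + \<i> / 2 * of_real (clip (Re c) (ln \<tau>)) =
      \<i> / 2 * (?I - of_real (0 - clip (Re c) (ln \<tau>)))"
    unfolding elliptic_log_real_eq[OF assms] by (simp add: algebra_simps)
  ultimately show ?thesis by (simp only: norm_mult norm_divide norm_ii norm_numeral)
qed

lemma H_horizontal_le':
  assumes "w \<in> slit_strip c" "w' \<in> slit_strip c" "Im w = Im w'"
  shows "cmod (H w' - H w - of_real (clip (Re c) (Re w') - clip (Re c) (Re w)) * (1 / (2 * \<i>))) \<le> pi + 5 + pi"
proof (cases "Re w \<le> Re w'")
  case True
  then show ?thesis
    using H_horizontal_le[of "Re w" "Im w" "Re w'"] assms by (metis complex.collapse)
next
  case False
  then have "cmod (H w - H w' - of_real (clip (Re c) (Re w) - clip (Re c) (Re w')) * (1 / (2 * \<i>))) \<le> pi + 5 + pi"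
    using H_horizontal_le[of "Re w'" "Im w" "Re w"] assms by (metis complex.collapse linear)
  then show ?thesis by (subst norm_minus_cancel[symmetric]) (simp add: algebra_simps)
qed

end

section \<open>Growth of the normalized primitive\<close>

locale legendre_normalized = legendre_primitive +
  assumes H_normalized: "H (Complex 0 pi) = elliptic_log_real lam (- 1)"
begin

lemma elliptic_log_real_eq_H:
  assumes "0 < \<tau>"
  shows "elliptic_log_real lam (- \<tau>) = H (Complex (ln \<tau>) pi)"
proof -
  have "set_integrable lborel (einterval (min \<tau> 1) \<infinity>) left_integrand"
    by (rule set_integrable_subset[OF set_integrable_left_integrand])
       (use assms in \<open>auto simp: einterval_def min_def split: if_splits\<close>)
  then have "interval_lebesgue_integrable lborel (min (ereal \<tau>) (min (ereal 1) \<infinity>)) (max (ereal \<tau>) (max (ereal 1) \<infinity>)) left_integrand"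
    by (cases "\<tau> \<le> 1") (simp_all add: interval_lebesgue_integrable_def min_def)
  then have "(LBINT t=\<tau>..\<infinity>. left_integrand t) = (LBINT t=\<tau>..ereal 1. left_integrand t) + (LBINT t=ereal 1..\<infinity>. left_integrand t)"
    by (rule interval_integral_sum[symmetric])
  then have "elliptic_log_real lam (- \<tau>) =
      \<i> / 2 * (LBINT t=\<tau>..ereal 1. left_integrand t) + elliptic_log_real lam (- 1)"
    unfolding elliptic_log_real_eq[OF assms] elliptic_log_real_eq[OF zero_less_one]
    by (simp only: distrib_left)
  also have "\<dots> = H (Complex (ln \<tau>) pi)"
    unfolding integral_left_integrand_eq[OF assms zero_less_one] H_normalized[symmetric] by (simp add: field_simps)
  finally show ?thesis .
qed

lemma H_estimate:
  assumes "w \<in> slit_strip c" "Im w \<le> pi"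
  shows "\<exists>\<sigma> e. H w = \<i> * of_real \<sigma> + e \<and> \<bar>\<sigma>\<bar> \<le> - Re c \<and> cmod e \<le> 52"
proof -
  define b where "b = Im w"
  define p where "p = transversal c b"
  define q where "q = transversal c pi"
  have b: "- pi < b" "b \<le> pi" using assms by (auto simp: b_def slit_strip_def)
  have p: "p \<in> slit_strip c" "Im p = b"
    using b transversal_in_slit_strip[OF Re_c c_nonzero, of b] by (auto simp: p_def)
  have q: "q = Complex (Re q) pi" by (simp add: q_def complex_eq_iff)
  have 1: "cmod (H q + \<i> / 2 * of_real (clip (Re c) (Re q))) \<le> 3"
    using elliptic_log_real_estimate[of "exp (Re q)"] elliptic_log_real_eq_H[of "exp (Re q)"]
    by (subst q) simp
  have 2: "cmod (H p - H q) \<le> 36"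
    using H_transversal_le[OF b] by (simp add: p_def q_def norm_minus_commute)
  have 3: "cmod (H w - H p - of_real (clip (Re c) (Re w) - clip (Re c) (Re p)) * (1 / (2 * \<i>))) \<le> pi + 5 + pi"
    using p assms by (intro H_horizontal_le') (auto simp: b_def)
  \<comment> \<open>As 1 / (2 \<i>) = -\<i>/2, these are the main terms of the two horizontal
    contributions. Each \<open>clip\<close> value lies between \<open>Re c\<close> and 0, and only
    two of the three carry a minus sign, so after halving the sum is at most \<open>- Re c\<close>
    in absolute value.\<close>
  define \<sigma> where "\<sigma> = (clip (Re c) (Re p) - clip (Re c) (Re w) - clip (Re c) (Re q)) / 2"
  have "H w - \<i> * of_real \<sigma> = (H q + \<i> / 2 * of_real (clip (Re c) (Re q))) + (H p - H q) +
      (H w - H p - of_real (clip (Re c) (Re w) - clip (Re c) (Re p)) * (1 / (2 * \<i>)))"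
    by (simp add: \<sigma>_def field_simps)
  also have "cmod \<dots> \<le> 3 + 36 + (pi + 5 + pi)"
    by (intro norm_triangle_mono 1 2 3)
  also have "\<dots> \<le> 52" using pi_less_4 by simp
  finally have "cmod (H w - \<i> * of_real \<sigma>) \<le> 52" .
  moreover have "Re c \<le> clip (Re c) x" "clip (Re c) x \<le> 0" for x using Re_c by (auto simp: clip_def)
  from this[of "Re p"] this[of "Re q"] this[of "Re w"] have "\<bar>\<sigma>\<bar> \<le> - Re c" unfolding \<sigma>_def by argo
  ultimately show ?thesis by (intro exI[of _ \<sigma>] exI[of _ "H w - \<i> * of_real \<sigma>"]) auto
qed

section \<open>The elliptic logarithm as a function on the strip\<close>

lemma Ln_in_slit_strip:
  assumes "xi \<in> slit_plane lam"
  shows "Ln xi \<in> slit_strip c" "Im (Ln xi) < pi"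
proof -
  have xi: "xi \<notin> of_real ` {..0}" "xi \<notin> closed_segment 0 lam" "xi \<notin> of_real ` {1..}"
    using assms by (auto simp: slit_plane_def)
  then have nz: "xi \<noteq> 0" by force
  define w where "w = Ln xi"
  have ex: "exp w = xi" using nz by (simp add: w_def)
  have Im: "- pi < Im w" "Im w \<le> pi" using mpi_less_Im_Ln[OF nz] Im_Ln_le_pi[OF nz] by (auto simp: w_def)
  have "Im w \<noteq> pi"
  proof
    assume "Im w = pi"
    then have "Re xi \<le> 0" "Im xi = 0" using Im_Ln_eq_pi[OF nz] by (auto simp: w_def)
    then have "xi = of_real (Re xi)" by (simp add: complex_eq_iff)
    with xi(1) \<open>Re xi \<le> 0\<close> show False by blast
  qed
  with Im show *: "Im (Ln xi) < pi" by (simp add: w_def)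
  have 1: False if "Im w = 0" "0 \<le> Re w"
  proof -
    have "xi = of_real (exp (Re w))" unfolding ex[symmetric] using that by (simp add: exp_eq_polar)
    moreover have "exp (Re w) \<in> {1..}" using that by simp
    ultimately show False using xi(3) by blast
  qed
  have 2: False if "Im w = Im c" "Re w \<le> Re c"
  proof -
    have "w = c + of_real (Re w - Re c)" using that by (simp add: complex_eq_iff del: Re_Ln)
    then have "xi = lam * of_real (exp (Re w - Re c))"
      unfolding ex[symmetric] by (metis exp_add exp_c exp_of_real)
    then have "xi = (1 - exp (Re w - Re c)) *\<^sub>R 0 + exp (Re w - Re c) *\<^sub>R lam"
      by (simp add: scaleR_conv_of_real mult.commute)
    moreover have "0 \<le> exp (Re w - Re c)" "exp (Re w - Re c) \<le> 1" using that by auto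
    ultimately show False using xi(2) unfolding in_segment by blast
  qed
  show "Ln xi \<in> slit_strip c" using Im * 1 2 by (auto simp: slit_strip_def w_def simp del: Re_Ln)
qed

lemma exp_in_slit_plane:
  assumes "w \<in> slit_strip c" "Im w < pi"
  shows "exp w \<in> slit_plane lam"
proof -
  have Im: "- pi < Im w" using assms by (simp add: slit_strip_def)
  then have Ln: "Ln (exp w) = w" using assms by (intro Ln_exp) auto
  have 1: False if "exp w = of_real y" "y \<le> 0" for y
  proof -
    have "y \<noteq> 0" using that by auto
    then have "Im (Ln (of_real y)) = pi" using Im_Ln_eq_pi[of "of_real y"] that by auto
    then show False using assms Ln that by simp
  qed
  have 2: False if "exp w = of_real y" "1 \<le> y" for y
  proof -
    have "w = of_real (ln y)" using Ln_of_real[of y] that Ln by simp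
    then show False using assms that by (auto simp: slit_strip_def)
  qed
  have 3: False if "exp w = of_real s * lam" "0 < s" "s \<le> 1" for s
  proof -
    have "w = of_real (ln s) + c"
      using Ln_times_of_real[of s lam] Ln_of_real[of s] that Ln legendre_regionD(1)[OF lam] by simp
    then show False using assms that by (auto simp: slit_strip_def simp del: Re_Ln)
  qed
  have 4: False if ex: "exp w \<in> closed_segment 0 lam"
  proof -
    obtain s where s: "0 \<le> s" "s \<le> 1" "exp w = of_real s * lam"
      using ex by (auto simp: in_segment scaleR_conv_of_real)
    moreover have "s \<noteq> 0" using s by auto
    ultimately show False using 3[of s] by simp
  qed
  show ?thesis unfolding slit_plane_def using 1 2 4 by auto
qed

lemma H_isCont_top: "isCont H (Complex a pi)"
  using H[OF top_in_slit_strip] by (rule DERIV_isCont)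

lemma is_elliptic_log_H_Ln: "is_elliptic_log lam (\<lambda>X. H (Ln X))"
  unfolding is_elliptic_log_def
proof (intro conjI allI impI)
  have "Ln holomorphic_on slit_plane lam"
  proof (rule holomorphic_on_subset[OF holomorphic_on_Ln])
    show "slit_plane lam \<subseteq> - \<real>\<^sub>\<le>\<^sub>0" by (auto simp: slit_plane_def elim!: nonpos_Reals_cases)
  qed auto
  then have "(H \<circ> Ln) holomorphic_on slit_plane lam"
    using Ln_in_slit_strip(1) by (intro holomorphic_on_compose_gen[OF _ holomorphic_H]) auto
  then show "(\<lambda>X. H (Ln X)) holomorphic_on slit_plane lam" by (simp add: o_def)
next
  fix x :: real assume x: "x < 0"
  let ?F = "at (complex_of_real x) within {w. 0 < Im w}"
  have Lx: "Ln (- of_real x) + \<i> * pi = Complex (ln (- x)) pi"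
    using Ln_of_real[of "- x"] x by (simp add: complex_eq_iff)
  \<comment> \<open>In the upper half plane Ln X = Ln (-X) + \<i> pi, and the right-hand side is
    continuous at negative reals, unlike \<open>Ln\<close> itself.\<close>
  have "((\<lambda>X. Ln (- X) + \<i> * pi) \<longlongrightarrow> Ln (- of_real x) + \<i> * pi) ?F"
    using x by (intro tendsto_intros) (auto simp: complex_nonpos_Reals_iff)
  then have "((\<lambda>X. H (Ln (- X) + \<i> * pi)) \<longlongrightarrow> H (Complex (ln (- x)) pi)) ?F"
    unfolding Lx by (rule isCont_tendsto_compose[OF H_isCont_top])
  moreover have "\<forall>\<^sub>F X in ?F. H (Ln (- X) + \<i> * pi) = H (Ln X)"
    unfolding eventually_at_filter
  proof (intro always_eventually allI impI)
    fix X :: complex assume "X \<in> {w. 0 < Im w}"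
    then have "Im X > 0" "X \<noteq> 0" by auto
    then show "H (Ln (- X) + \<i> * pi) = H (Ln X)" using Ln_minus[of X] by auto
  qed
  ultimately have "((\<lambda>X. H (Ln X)) \<longlongrightarrow> H (Complex (ln (- x)) pi)) ?F"
    by (rule Lim_transform_eventually)
  then show "((\<lambda>X. H (Ln X)) \<longlongrightarrow> elliptic_log_real lam x) ?F"
    using elliptic_log_real_eq_H[of "- x"] x by simp
qed

text \<open>Paste z o exp below the line Im w = pi to \<open>H\<close> on and above it. Equal
  boundary values make the result continuous, hence holomorphic across the line, and it agrees with
  \<open>H\<close> on an open set; the identity theorem on the connected strip carries this down to
  \<open>Ln xi\<close>.\<close>

lemma elliptic_log_unique:
  assumes z: "is_elliptic_log lam z" and xi: "xi \<in> slit_plane lam"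
  shows "z xi = H (Ln xi)"
proof -
  let ?S = "slit_strip c"
  have hol: "z holomorphic_on slit_plane lam"
    and lim: "\<And>x. x < 0 \<Longrightarrow> (z \<longlongrightarrow> elliptic_log_real lam x) (at (of_real x) within {w. 0 < Im w})"
    using z by (auto simp: is_elliptic_log_def)
  define g where "g w = (if Im w < pi then z (exp w) else H w)" for w
  have open_S: "open (?S \<inter> {w. Im w < pi})" "open (?S \<inter> {w. pi < Im w})"
    by (auto intro!: open_Int open_slit_strip open_halfspace_Im_lt open_halfspace_Im_gt)
  have hol1: "g holomorphic_on (?S \<inter> {w. Im w < pi})"
  proof (rule holomorphic_transform)
    have "exp holomorphic_on (?S \<inter> {w. Im w < pi})" by (intro holomorphic_intros)
    then show "(z \<circ> exp) holomorphic_on (?S \<inter> {w. Im w < pi})"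
      using exp_in_slit_plane by (intro holomorphic_on_compose_gen[OF _ hol]) auto
  qed (auto simp: g_def)
  have hol2: "g holomorphic_on (?S \<inter> {w. pi < Im w})"
    by (rule holomorphic_transform[OF holomorphic_on_subset[OF holomorphic_H]]) (auto simp: g_def)
  have cont: "isCont g w" if w: "w \<in> ?S" for w
  proof -
    consider "Im w < pi" | "pi < Im w" | "Im w = pi" by linarith
    then show ?thesis
    proof cases
      case 1
      then show ?thesis
        using holomorphic_on_imp_continuous_on[OF hol1] open_S w
        by (auto simp: continuous_on_eq_continuous_at)
    next
      case 2
      then show ?thesis
        using holomorphic_on_imp_continuous_on[OF hol2] open_S w
        by (auto simp: continuous_on_eq_continuous_at)
    next
      case 3
      define a where "a = Re w"
      have wa: "w = Complex a pi" using 3 by (simp add: a_def complex_eq_iff)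
      have exw: "exp w = of_real (- exp a)" by (simp add: wa exp_eq_polar)
      have gw: "g w = H w" using 3 by (simp add: g_def)
      have Ew: "elliptic_log_real lam (- exp a) = H w"
        using elliptic_log_real_eq_H[of "exp a"] by (simp add: wa)
      have "(g \<longlongrightarrow> H w) (at w within {v. pi \<le> Im v})"
      proof (rule Lim_transform_eventually)
        show "(H \<longlongrightarrow> H w) (at w within {v. pi \<le> Im v})"
          using H_isCont_top[of a] wa by (metis isCont_def tendsto_within_subset top_greatest)
        show "\<forall>\<^sub>F v in at w within {v. pi \<le> Im v}. H v = g v"
          unfolding eventually_at_filter by (intro always_eventually) (auto simp: g_def)
      qed
      moreover have "(g \<longlongrightarrow> H w) (at w within {v. Im v < pi})"
      proof (rule Lim_transform_eventually)
        have "(exp \<longlongrightarrow> exp w) (at w within {v. Im v < pi})" by (intro tendsto_intros)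
        \<comment> \<open>The boundary condition on \<open>z\<close> is a limit from the open upper
          half plane, so \<open>exp v\<close> has to approach from there; just below Im w = pi the
          sine of \<open>Im v\<close> is positive.\<close>
        moreover have "\<forall>\<^sub>F v in at w within {v. Im v < pi}. exp v \<in> {w. 0 < Im w} \<and> exp v \<noteq> exp w"
        proof -
          have "((\<lambda>v. Im v) \<longlongrightarrow> Im w) (at w within {v. Im v < pi})" by (intro tendsto_intros)
          then have "\<forall>\<^sub>F v in at w within {v. Im v < pi}. 0 < Im v"
            by (rule order_tendstoD(1)) (simp add: 3)
          moreover have "\<forall>\<^sub>F v in at w within {v. Im v < pi}. Im v < pi"
            unfolding eventually_at_filter by (intro always_eventually) auto
          ultimately show ?thesis
          proof eventually_elim
            case (elim v)
            have "0 < Im (exp v)" using elim by (simp add: Im_exp sin_gt_zero)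
            moreover have "Im (exp w) = 0" by (simp add: exw)
            ultimately show ?case by auto
          qed
        qed
        ultimately have "filterlim exp (at (of_real (- exp a)) within {w. 0 < Im w}) (at w within {v. Im v < pi})"
          unfolding filterlim_at exw by auto
        from filterlim_compose[OF lim this]
        show "((\<lambda>v. z (exp v)) \<longlongrightarrow> H w) (at w within {v. Im v < pi})" unfolding Ew by simp
        show "\<forall>\<^sub>F v in at w within {v. Im v < pi}. z (exp v) = g v"
          unfolding eventually_at_filter by (intro always_eventually) (auto simp: g_def)
      qed
      ultimately have "(g \<longlongrightarrow> H w) (at w)" by (rule Lim_Un_univ) auto
      then show ?thesis by (simp add: isCont_def gw)
    qed
  qed
  have "g holomorphic_on ?S"
  proof (rule holomorphic_on_paste_across_line[where d = \<i> and k = pi])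
    show "g holomorphic_on (?S \<inter> {z. \<i> \<bullet> z < pi})" using hol1 by (simp add: inner_complex_def)
    show "g holomorphic_on (?S \<inter> {z. pi < \<i> \<bullet> z})" using hol2 by (simp add: inner_complex_def)
    show "continuous_on ?S g" using cont by (intro continuous_at_imp_continuous_on) auto
  qed (auto simp: open_slit_strip)
  moreover have "- pi < pi + 1/2" using pi_gt_zero by linarith
  then have "transversal c (pi + 1/2) \<in> ?S \<inter> {w. pi < Im w}"
    by (simp add: transversal_in_slit_strip[OF Re_c c_nonzero])
  then have "?S \<inter> {w. pi < Im w} \<noteq> {}" by blast
  moreover have "g w = H w" if "w \<in> ?S \<inter> {w. pi < Im w}" for w
    using that by (simp add: g_def)
  ultimately have "g (Ln xi) = H (Ln xi)"
    using analytic_continuation_open[OF open_S(2) open_slit_strip _ connected_slit_strip[OF Re_c c_nonzero]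
        Int_lower1 _ holomorphic_H _ Ln_in_slit_strip(1)[OF xi]] by blast
  moreover have "xi \<noteq> 0" using xi by (auto simp: slit_plane_def image_iff)
  ultimately show ?thesis using Ln_in_slit_strip[OF xi] by (simp add: g_def)
qed

lemma elliptic_log_eq_H: "xi \<in> slit_plane lam \<Longrightarrow> elliptic_log lam xi = H (Ln xi)"
  unfolding elliptic_log_def
  by (rule elliptic_log_unique) (rule someI[of "is_elliptic_log lam", OF is_elliptic_log_H_Ln])

text \<open>The Betti coordinates are real-linear in \<open>z\<close> and those of \<omega>2 are 0
  and 1, so the possibly large real multiple of \<omega>2 contributes only its coefficient
  \<open>s\<close>.\<close>

lemma betti_le:
  assumes "xi \<in> slit_plane lam"
  shows "cmod (betti1 lam xi) \<le> 42" "cmod (betti2 lam xi) \<le> 42"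
proof -
  define z where "z = elliptic_log lam xi"
  obtain \<sigma> e where H: "H (Ln xi) = \<i> * of_real \<sigma> + e" "\<bar>\<sigma>\<bar> \<le> - Re c" "cmod e \<le> 52"
    using H_estimate[OF Ln_in_slit_strip(1)[OF assms]] Ln_in_slit_strip(2)[OF assms] by auto
  \<comment> \<open>If \<open>Re c = 0\<close>, division by zero makes \<open>s\<close> equal to 0,
    which is right since \<sigma> then vanishes.\<close>
  define s where "s = \<sigma> / (- Re c)"
  have \<sigma>: "\<sigma> = s * (- Re c)" using H(2) by (cases "Re c = 0") (auto simp: s_def simp del: Re_Ln)
  have s: "\<bar>s\<bar> \<le> 1"
  proof (cases "Re c = 0")
    case False
    then have "0 < - Re c" using Re_c by linarith
    then show ?thesis
      unfolding s_def abs_divide abs_of_pos[OF \<open>0 < - Re c\<close>] using H(2) by (simp only: divide_le_eq_1_pos)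
  qed (simp add: s_def del: Re_Ln)
  \<comment> \<open>Trading \<i> \<sigma> for \<open>s\<close> times \<omega>2 costs at most the
    error 6 in the size of \<omega>2.\<close>
  define e' where "e' = e - of_real s * (omega2 lam - \<i> * of_real (- Re c))"
  have z: "z = of_real s * omega2 lam + e'"
    unfolding z_def elliptic_log_eq_H[OF assms] H(1) by (simp add: e'_def \<sigma> algebra_simps del: Re_Ln)
  have "cmod e' \<le> cmod e + \<bar>s\<bar> * cmod (omega2 lam - \<i> * of_real (- Re c))"
    unfolding e'_def by (metis norm_mult norm_of_real norm_triangle_ineq4)
  also have "\<dots> \<le> 52 + 1 * 6"
    using H(3) s omega2_estimate by (intro add_mono mult_mono) auto
  finally have e': "cmod e' \<le> 58" by simp
  let ?w1 = "omega1 lam" and ?w2 = "omega2 lam" and ?A = "betti_denom lam"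
  note pi3 = pi_gt3
  have I: "3 \<le> right_mass" "3 \<le> left_mass" using mass_ge_pi pi3 by auto
  have "0 < right_mass * left_mass" using I by simp
  then have A: "0 < cmod ?A" "right_mass * left_mass \<le> cmod ?A" using cmod_betti_denom_ge by auto
  \<comment> \<open>\<open>I\<close> is the mass belonging to the period \<open>w\<close>; the other
    mass is at least pi, so it may be cancelled. The numerator 116 is twice 58.\<close>
  have est: "cmod ((cnj w * e' - w * cnj e') / ?A) \<le> 116 / pi" if "cmod w \<le> I" "I * pi \<le> right_mass * left_mass" for w I
  proof -
    have "cmod (cnj w * e' - w * cnj e') \<le> 2 * (cmod w * cmod e')"
      using norm_triangle_ineq4[of "cnj w * e'" "w * cnj e'"] by (simp add: norm_mult mult.commute)
    also have "\<dots> \<le> 2 * (I * 58)"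
      using that(1) e' order_trans[OF norm_ge_zero that(1)] by (intro mult_left_mono mult_mono) auto
    finally have "cmod (cnj w * e' - w * cnj e') \<le> 116 * I" by simp
    moreover have "116 * I \<le> 116 / pi * cmod ?A"
      using that(2) A pi3 by (simp add: field_simps)
    ultimately show ?thesis using A by (simp add: norm_divide divide_le_eq)
  qed
  have pi_bd: "116 / pi \<le> 41" using pi3 by (simp add: divide_le_eq)
  have "betti1 lam xi = (cnj ?w2 * e' - ?w2 * cnj e') / ?A"
    unfolding betti1_def z_def[symmetric] z by (simp add: algebra_simps)
  then show "cmod (betti1 lam xi) \<le> 42"
    using est[of ?w2 left_mass] cmod_omega_le mass_ge_pi I pi_bd by (simp add: mult.commute mult_right_mono)
  have "betti2 lam xi = of_real s - (cnj ?w1 * e' - ?w1 * cnj e') / ?A"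
  proof -
    have "?w1 * cnj z - cnj ?w1 * z = of_real s * ?A - (cnj ?w1 * e' - ?w1 * cnj e')"
      unfolding z betti_denom_def by (simp add: algebra_simps)
    then show ?thesis unfolding betti2_def z_def[symmetric] using A by (simp add: diff_divide_distrib)
  qed
  then have "cmod (betti2 lam xi) \<le> \<bar>s\<bar> + cmod ((cnj ?w1 * e' - ?w1 * cnj e') / ?A)"
    by (metis norm_of_real norm_triangle_ineq4)
  then show "cmod (betti2 lam xi) \<le> 42"
    using est[of ?w1 right_mass] cmod_omega_le mass_ge_pi I s pi_bd by (simp add: mult_left_mono)
qed

end

theorem proposition4:
  fixes lam xi :: complex
  assumes "lam \<in> legendre_region" and "xi \<in> slit_plane lam"
  shows "max (cmod (betti1 lam xi)) (cmod (betti2 lam xi)) \<le> 42"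
proof -
  interpret legendre_param lam by standard (rule assms)
  have "simply_connected (slit_strip c)" by (rule simply_connected_slit_strip[OF Re_c c_nonzero])
  then obtain H0 where H0: "\<And>w. w \<in> slit_strip c \<Longrightarrow> (H0 has_field_derivative log_form lam w) (at w)"
    using simply_connected_eq_global_primitive[OF open_slit_strip] holomorphic_log_form by metis
  define H where "H w = H0 w + (elliptic_log_real lam (- 1) - H0 (Complex 0 pi))" for w
  interpret legendre_normalized lam H
  proof
    show "(H has_field_derivative log_form lam w) (at w)" if "w \<in> slit_strip c" for w
      unfolding H_def using DERIV_add[OF H0[OF that] DERIV_const] by simp
    show "H (Complex 0 pi) = elliptic_log_real lam (- 1)" by (simp add: H_def)
  qed
  show ?thesis using betti_le[OF assms(2)] by simp
qed

end
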